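(* Let $\kappa\in\mathbb{R}$, let $(X,d_X)$ be a $\mathrm{CAT}(\kappa)$ space, and let $p_1,p_2,p_3,p_4\in X$, with $d_{ij}:=d_X(p_i,p_j)$, be such that $d_{12}+d_{23}+d_{34}+d_{41}<2D_\kappa$. Then $$s_\kappa(d_{13}/2)\,s_\kappa(d_{24}/2)\le s_\kappa(d_{12}/2)\,s_\kappa(d_{34}/2)+s_\kappa(d_{41}/2)\,s_\kappa(d_{23}/2).$$
   Context: For $\kappa\in\mathbb{R}$, $D_\kappa:=\pi/\sqrt{\kappa}$ if $\kappa>0$ and $D_\kappa:=\infty$ if $\kappa\le 0$. The function $s_\kappa:[0,\infty)\to\mathbb{R}$ is defined by $s_\kappa(t)=\frac{1}{\sqrt{\kappa}}\sin(\sqrt{\kappa}\,t)$ if $\kappa>0$, $s_0(t)=t$, and $s_\kappa(t)=\frac{1}{\sqrt{-\kappa}}\sinh(\sqrt{-\kappa}\,t)$ if $\kappa<0$. Model spaces. For $x,y\in\mathbb{R}^{n+1}$ let $\langle x,y\rangle=x_0y_0+\dots+x_ny_n$ and $\langle x|y\rangle=-x_0y_0+x_1y_1+\dots+x_ny_n$. Then $M_\kappa^n=\{x\in\mathbb{R}^{n+1}:\langle x,x\rangle=1/\kappa\}$ with distance $\frac{1}{\sqrt{\kappa}}\arccos(\kappa\langle x,y\rangle)$ if $\kappa>0$; $M_0^n=\mathbb{R}^n$ with the Euclidean distance; and $M_\kappa^n=\{x\in\mathbb{R}^{n+1}:\langle x|x\rangle=1/\kappa,\ x_0>0\}$ with distance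 $\frac{1}{\sqrt{-\kappa}}\operatorname{arcosh}(\kappa\langle x|y\rangle)$ if $\kappa<0$. $\mathrm{CAT}(\kappa)$ spaces. Let $(X,d_X)$ be a geodesic metric space. A geodesic triangle $\Delta\subset X$ with vertices $x,y,z$ is the union of three geodesic segments $[x,y],[y,z],[z,x]$. If $d_X(x,y)+d_X(y,z)+d_X(z,x)<2D_\kappa$, a comparison triangle $\overline{\Delta}\subset M_\kappa^2$ is a geodesic triangle with vertices $\overline{x},\overline{y},\overline{z}$ having the same side lengths, i.e. $d_{M_\kappa^2}(\overline{x},\overline{y})=d_X(x,y)$, and similarly for the other two pairs. A comparison point for $p\in[x,y]$ is the point $\overline{p}\in[\overline{x},\overline{y}]$ with $d_{M_\kappa^2}(\overline{p},\overline{x})=d_X(p,x)$ (similarly for the other sides). $X$ is a $\mathrm{CAT}(\kappa)$ space if for every geodesic triangle $\Delta$ in $X$ (of perimeter less than $2D_\kappa$) and all $p,q\in\Delta$, the comparison points satisfy $d_X(p,q)\le d_{M_\kappa^2}(\overline{p},\overline{q})$. *)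

theory Defs
  imports "HOL-Analysis.Analysis"
begin

definition D_kappa :: "real \<Rightarrow> ereal" where
  "D_kappa \<kappa> = (if \<kappa> > 0 then ereal (pi / sqrt \<kappa>) else \<infinity>)"

text \<open>The arguments of interest are \<open>t \<ge> 0\<close>; the values at negative \<open>t\<close> are never used.\<close>

definition s_kappa :: "real \<Rightarrow> real \<Rightarrow> real" where
  "s_kappa \<kappa> t =
     (if \<kappa> > 0 then sin (sqrt \<kappa> * t) / sqrt \<kappa>
      else if \<kappa> = 0 then t
      else sinh (sqrt (- \<kappa>) * t) / sqrt (- \<kappa>))"


section \<open>Model spaces\<close>

text \<open>
  The ambient space of the model space depends on \<open>\<kappa>\<close> (it has one more dimension if
  \<open>\<kappa> \<noteq> 0\<close>). As in \<^const>\<open>Euclidean_space\<close>, vectors with \<open>m\<close> coordinates are therefore represented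
  by functions \<open>x :: nat \<Rightarrow> real\<close> with coordinates \<open>x 0, \<dots>, x (m - 1)\<close> and \<open>x i = 0\<close> for \<open>i \<ge> m\<close>.
\<close>

definition inner_prod :: "nat \<Rightarrow> (nat \<Rightarrow> real) \<Rightarrow> (nat \<Rightarrow> real) \<Rightarrow> real" where
  "inner_prod n x y = (\<Sum>i=0..n. x i * y i)"

definition lorentz_prod :: "nat \<Rightarrow> (nat \<Rightarrow> real) \<Rightarrow> (nat \<Rightarrow> real) \<Rightarrow> real" where
  "lorentz_prod n x y = - (x 0 * y 0) + (\<Sum>i=1..n. x i * y i)"

definition model_space :: "real \<Rightarrow> nat \<Rightarrow> (nat \<Rightarrow> real) set" where
  "model_space \<kappa> n =
     (if \<kappa> > 0 then {x \<in> topspace (Euclidean_space (n + 1)). inner_prod n x x = 1 / \<kappa>}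
      else if \<kappa> = 0 then topspace (Euclidean_space n)
      else {x \<in> topspace (Euclidean_space (n + 1)). lorentz_prod n x x = 1 / \<kappa> \<and> x 0 > 0})"

definition model_dist :: "real \<Rightarrow> nat \<Rightarrow> (nat \<Rightarrow> real) \<Rightarrow> (nat \<Rightarrow> real) \<Rightarrow> real" where
  "model_dist \<kappa> n x y =
     (if \<kappa> > 0 then arccos (\<kappa> * inner_prod n x y) / sqrt \<kappa>
      else if \<kappa> = 0 then L2_set (\<lambda>i. x i - y i) {..<n}
      else arcosh (\<kappa> * lorentz_prod n x y) / sqrt (- \<kappa>))"


section \<open>Geodesic triangles and CAT(\<open>\<kappa>\<close>) spaces\<close>

definition geodesic_segment ::
  "'a set \<Rightarrow> ('a \<Rightarrow> 'a \<Rightarrow> real) \<Rightarrow> 'a \<Rightarrow> 'a \<Rightarrow> 'a set \<Rightarrow> bool" where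
  "geodesic_segment X d x y S \<longleftrightarrow>
     (\<exists>c l. l \<ge> 0 \<and> c 0 = x \<and> c l = y \<and> c ` {0..l} \<subseteq> X \<and>
        (\<forall>t\<in>{0..l}. \<forall>t'\<in>{0..l}. d (c t) (c t') = \<bar>t - t'\<bar>) \<and> S = c ` {0..l})"

definition geodesic_metric_space :: "'a set \<Rightarrow> ('a \<Rightarrow> 'a \<Rightarrow> real) \<Rightarrow> bool" where
  "geodesic_metric_space X d \<longleftrightarrow>
     Metric_space X d \<and> (\<forall>x\<in>X. \<forall>y\<in>X. \<exists>S. geodesic_segment X d x y S)"

text \<open>
  A geodesic triangle is recorded by its vertices \<open>x\<close>, \<open>y\<close>, \<open>z\<close> and its sides \<open>A\<close>, \<open>B\<close>, \<open>C\<close>,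
  chosen geodesic segments \<open>[x,y]\<close>, \<open>[y,z]\<close>, \<open>[z,x]\<close>; the triangle itself is \<open>A \<union> B \<union> C\<close>.
\<close>

definition geodesic_triangle ::
  "'a set \<Rightarrow> ('a \<Rightarrow> 'a \<Rightarrow> real) \<Rightarrow> 'a \<Rightarrow> 'a \<Rightarrow> 'a \<Rightarrow> 'a set \<Rightarrow> 'a set \<Rightarrow> 'a set \<Rightarrow> bool" where
  "geodesic_triangle X d x y z A B C \<longleftrightarrow>
     geodesic_segment X d x y A \<and> geodesic_segment X d y z B \<and> geodesic_segment X d z x C"

definition comparison_triangle ::
  "real \<Rightarrow> ('a \<Rightarrow> 'a \<Rightarrow> real) \<Rightarrow> 'a \<Rightarrow> 'a \<Rightarrow> 'a \<Rightarrow>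
   (nat \<Rightarrow> real) \<Rightarrow> (nat \<Rightarrow> real) \<Rightarrow> (nat \<Rightarrow> real) \<Rightarrow>
   (nat \<Rightarrow> real) set \<Rightarrow> (nat \<Rightarrow> real) set \<Rightarrow> (nat \<Rightarrow> real) set \<Rightarrow> bool" where
  "comparison_triangle \<kappa> d x y z x' y' z' A' B' C' \<longleftrightarrow>
     geodesic_triangle (model_space \<kappa> 2) (model_dist \<kappa> 2) x' y' z' A' B' C' \<and>
     model_dist \<kappa> 2 x' y' = d x y \<and>
     model_dist \<kappa> 2 y' z' = d y z \<and>
     model_dist \<kappa> 2 z' x' = d z x"

text \<open>
  \<open>p'\<close> is a comparison point for \<open>p\<close> if, for some side containing \<open>p\<close>, it is the point of the
  corresponding comparison side at the same distance from the initial vertex. A point lying on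
  several sides may have several comparison points.
\<close>

definition comparison_point ::
  "real \<Rightarrow> ('a \<Rightarrow> 'a \<Rightarrow> real) \<Rightarrow> 'a \<Rightarrow> 'a \<Rightarrow> 'a \<Rightarrow> 'a set \<Rightarrow> 'a set \<Rightarrow> 'a set \<Rightarrow>
   (nat \<Rightarrow> real) \<Rightarrow> (nat \<Rightarrow> real) \<Rightarrow> (nat \<Rightarrow> real) \<Rightarrow>
   (nat \<Rightarrow> real) set \<Rightarrow> (nat \<Rightarrow> real) set \<Rightarrow> (nat \<Rightarrow> real) set \<Rightarrow>
   'a \<Rightarrow> (nat \<Rightarrow> real) \<Rightarrow> bool" where
  "comparison_point \<kappa> d x y z A B C x' y' z' A' B' C' p p' \<longleftrightarrow>
     p \<in> A \<and> p' \<in> A' \<and> model_dist \<kappa> 2 p' x' = d p x \<or>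
     p \<in> B \<and> p' \<in> B' \<and> model_dist \<kappa> 2 p' y' = d p y \<or>
     p \<in> C \<and> p' \<in> C' \<and> model_dist \<kappa> 2 p' z' = d p z"

definition CAT :: "real \<Rightarrow> 'a set \<Rightarrow> ('a \<Rightarrow> 'a \<Rightarrow> real) \<Rightarrow> bool" where
  "CAT \<kappa> X d \<longleftrightarrow>
     geodesic_metric_space X d \<and>
     (\<forall>x y z A B C x' y' z' A' B' C'.
        geodesic_triangle X d x y z A B C \<longrightarrow>
        ereal (d x y + d y z + d z x) < 2 * D_kappa \<kappa> \<longrightarrow>
        comparison_triangle \<kappa> d x y z x' y' z' A' B' C' \<longrightarrow>
        (\<forall>p \<in> A \<union> B \<union> C. \<forall>q \<in> A \<union> B \<union> C. \<forall>p' q'.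
           comparison_point \<kappa> d x y z A B C x' y' z' A' B' C' p p' \<longrightarrow>
           comparison_point \<kappa> d x y z A B C x' y' z' A' B' C' q q' \<longrightarrow>
           d p q \<le> model_dist \<kappa> 2 p' q'))"

end

theory Submission
  imports Defs
begin

text \<open>
  Let \<open>m\<close> run along a geodesic from \<open>p\<^sub>1\<close> to \<open>p\<^sub>3\<close>. Comparison in the triangles \<open>p\<^sub>1 p\<^sub>3 p\<^sub>2\<close> and
  \<open>p\<^sub>1 p\<^sub>3 p\<^sub>4\<close> bounds \<open>d p\<^sub>2 p\<^sub>4\<close> by \<open>f + g\<close>, where \<open>f\<close> and \<open>g\<close> are the distances of the comparison
  point of \<open>m\<close> to the apices of the comparison triangles. Choose \<open>m\<close> such that \<open>f + g\<close> is minimal.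
  If \<open>m\<close> is an interior point, the derivative of \<open>f + g\<close> vanishes, which means that the apices,
  placed on opposite sides of the base, and \<open>m\<close> lie on a line, and the claim is Ptolemy's
  inequality in the model plane; after stereographic projection from \<open>m\<close> this is the Euclidean
  one. If \<open>m\<close> is an endpoint, say \<open>p\<^sub>3\<close>, the sign of the derivative bounds \<open>d p\<^sub>1 p\<^sub>3\<close> from above in
  terms of the sides, and the claim with \<open>d p\<^sub>2 p\<^sub>3 + d p\<^sub>3 p\<^sub>4\<close> in place of \<open>d p\<^sub>2 p\<^sub>4\<close> reduces to an
  identity between half angles. Working with \<open>2 s\<^sub>\<kappa>(t/2)\<^sup>2\<close> instead of the cosine treats all signs
  of \<open>\<kappa>\<close> at once.
\<close>

section \<open>Trigonometry of constant curvature\<close>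

definition c_kappa :: "real \<Rightarrow> real \<Rightarrow> real" where
  "c_kappa \<kappa> t = (if \<kappa> \<ge> 0 then cos (sqrt \<kappa> * t) else cosh (sqrt (- \<kappa>) * t))"

text \<open>The division by \<open>\<kappa>\<close> in \<open>(1 - c_kappa \<kappa> t) / \<kappa>\<close> is carried out, so that the law of cosines
  below does not degenerate for \<open>\<kappa> = 0\<close>.\<close>

definition vers_kappa :: "real \<Rightarrow> real \<Rightarrow> real" where
  "vers_kappa \<kappa> t = 2 * (s_kappa \<kappa> (t / 2))\<^sup>2"

text \<open>The inverse of \<^term>\<open>vers_kappa \<kappa>\<close> on \<open>[0, D\<^sub>\<kappa>]\<close>.\<close>

definition arc_kappa :: "real \<Rightarrow> real \<Rightarrow> real" where
  "arc_kappa \<kappa> y =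
     (if \<kappa> > 0 then arccos (1 - \<kappa> * y) / sqrt \<kappa>
      else if \<kappa> = 0 then sqrt (2 * y)
      else arcosh (1 - \<kappa> * y) / sqrt (- \<kappa>))"

text \<open>Turns the extended real bound into a downward closed predicate, vacuous for \<kappa> <=
  0, so that one argument serves all signs of \<kappa>.\<close>

definition below_D :: "real \<Rightarrow> real \<Rightarrow> bool" where
  "below_D \<kappa> t \<longleftrightarrow> ereal t < D_kappa \<kappa>"

lemma below_D_iff: "below_D \<kappa> t \<longleftrightarrow> (\<kappa> > 0 \<longrightarrow> sqrt \<kappa> * t < pi)"
  by (auto simp: below_D_def D_kappa_def field_simps)

lemma below_D_mono: "below_D \<kappa> t \<Longrightarrow> u \<le> t \<Longrightarrow> below_D \<kappa> u"
  unfolding below_D_def by (meson ereal_less_eq(3) order_le_less_trans)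

lemma below_D_half: "below_D \<kappa> (t / 2) \<longleftrightarrow> ereal t < 2 * D_kappa \<kappa>"
  by (auto simp: below_D_def D_kappa_def field_simps numeral_eq_ereal)

section \<open>Identities of trigonometry in curvature \<kappa>\<close>

lemma s_kappa_0 [simp]: "s_kappa \<kappa> 0 = 0"
  by (simp add: s_kappa_def)

lemma c_kappa_0 [simp]: "c_kappa \<kappa> 0 = 1"
  by (simp add: c_kappa_def)

lemma s_kappa_minus [simp]: "s_kappa \<kappa> (- t) = - s_kappa \<kappa> t"
  by (simp add: s_kappa_def)

lemma c_kappa_minus [simp]: "c_kappa \<kappa> (- t) = c_kappa \<kappa> t"
  by (simp add: c_kappa_def)

lemma c_kappa_squared: "(c_kappa \<kappa> t)\<^sup>2 = 1 - \<kappa> * (s_kappa \<kappa> t)\<^sup>2"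
proof -
  consider "\<kappa> > 0" | "\<kappa> = 0" | "\<kappa> < 0" by linarith
  then show ?thesis
  proof cases
    case 3
    have "(cosh (sqrt (- \<kappa>) * t))\<^sup>2 = 1 + (sinh (sqrt (- \<kappa>) * t))\<^sup>2"
      by (simp add: cosh_square_eq)
    with 3 show ?thesis by (simp add: c_kappa_def s_kappa_def power_divide)
  qed (simp_all add: c_kappa_def s_kappa_def cos_squared_eq power_divide)
qed

lemma s_kappa_add: "s_kappa \<kappa> (x + y) = s_kappa \<kappa> x * c_kappa \<kappa> y + c_kappa \<kappa> x * s_kappa \<kappa> y"
  by (simp add: c_kappa_def s_kappa_def distrib_left sin_add sinh_add add_divide_distrib)

lemma c_kappa_add: "c_kappa \<kappa> (x + y) = c_kappa \<kappa> x * c_kappa \<kappa> y - \<kappa> * s_kappa \<kappa> x * s_kappa \<kappa> y"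
proof -
  have "sqrt (-\<kappa>) * sqrt (-\<kappa>) = -\<kappa>" if "\<kappa> < 0" using that by simp
  then show ?thesis
    by (simp add: c_kappa_def s_kappa_def distrib_left cos_add cosh_add field_simps)
qed

lemma s_kappa_diff: "s_kappa \<kappa> (x - y) = s_kappa \<kappa> x * c_kappa \<kappa> y - c_kappa \<kappa> x * s_kappa \<kappa> y"
  using s_kappa_add[of \<kappa> x "- y"] by simp

lemma c_kappa_diff: "c_kappa \<kappa> (x - y) = c_kappa \<kappa> x * c_kappa \<kappa> y + \<kappa> * s_kappa \<kappa> x * s_kappa \<kappa> y"
  using c_kappa_add[of \<kappa> x "- y"] by simp

lemma s_kappa_half: "s_kappa \<kappa> t = 2 * s_kappa \<kappa> (t / 2) * c_kappa \<kappa> (t / 2)"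
  using s_kappa_add[of \<kappa> "t / 2" "t / 2"] by simp

lemma c_kappa_vers: "c_kappa \<kappa> t = 1 - \<kappa> * vers_kappa \<kappa> t"
  using c_kappa_add[of \<kappa> "t / 2" "t / 2"] c_kappa_squared[of \<kappa> "t / 2"]
  by (simp add: vers_kappa_def power2_eq_square)

lemma vers_kappa_nonneg: "0 \<le> vers_kappa \<kappa> t"
  by (simp add: vers_kappa_def)

lemma vers_kappa_le: "\<kappa> * vers_kappa \<kappa> t \<le> 2"
  using zero_le_power2[of "c_kappa \<kappa> (t / 2)"]
  unfolding vers_kappa_def c_kappa_squared by linarith

lemma vers_kappa_minus [simp]: "vers_kappa \<kappa> (- t) = vers_kappa \<kappa> t"
  using s_kappa_minus[of \<kappa> "t / 2"] by (simp add: vers_kappa_def)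

lemma vers_kappa_0 [simp]: "vers_kappa \<kappa> 0 = 0"
  by (simp add: vers_kappa_def)

lemma s_kappa_squared_vers: "(s_kappa \<kappa> t)\<^sup>2 = vers_kappa \<kappa> t * (2 - \<kappa> * vers_kappa \<kappa> t)"
proof -
  have "(s_kappa \<kappa> t)\<^sup>2 = 4 * (s_kappa \<kappa> (t/2))\<^sup>2 * (c_kappa \<kappa> (t/2))\<^sup>2"
    using s_kappa_half[of \<kappa> t] by (simp add: power_mult_distrib)
  then show ?thesis unfolding c_kappa_squared vers_kappa_def by (simp add: algebra_simps)
qed

text \<open>The law of cosines for a degenerate triangle with angle \<pi>. Multiplying the last term
  by minus the cosine of the angle gives the general law, the form in which all triangles below are
  described.\<close>

lemma vers_kappa_add:
  "vers_kappa \<kappa> (x + y) = vers_kappa \<kappa> x + vers_kappa \<kappa> y - \<kappa> * vers_kappa \<kappa> x * vers_kappa \<kappa> y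
     + s_kappa \<kappa> x * s_kappa \<kappa> y"
proof -
  define S C S' C' where "S = s_kappa \<kappa> (x/2)" and "C = c_kappa \<kappa> (x/2)"
    and "S' = s_kappa \<kappa> (y/2)" and "C' = c_kappa \<kappa> (y/2)"
  have "C\<^sup>2 = 1 - \<kappa> * S\<^sup>2" "C'\<^sup>2 = 1 - \<kappa> * S'\<^sup>2"
    by (simp_all add: S_def C_def S'_def C'_def c_kappa_squared)
  then have "2 * (S * C' + C * S')\<^sup>2 = 2 * S\<^sup>2 + 2 * S'\<^sup>2 - \<kappa> * (2 * S\<^sup>2) * (2 * S'\<^sup>2) + (2 * S * C) * (2 * S' * C')"
    by algebra
  then show ?thesis
    unfolding vers_kappa_def s_kappa_half[of \<kappa> x] s_kappa_half[of \<kappa> y] add_divide_distrib s_kappa_add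
      S_def C_def S'_def C'_def .
qed

lemma vers_kappa_diff:
  "vers_kappa \<kappa> (x - y) = vers_kappa \<kappa> x + vers_kappa \<kappa> y - \<kappa> * vers_kappa \<kappa> x * vers_kappa \<kappa> y
     - s_kappa \<kappa> x * s_kappa \<kappa> y"
  using vers_kappa_add[of \<kappa> x "- y"] by simp

section \<open>Signs and monotonicity up to \<open>D_kappa \<kappa>\<close>\<close>

lemma s_kappa_pos: "0 < t \<Longrightarrow> below_D \<kappa> t \<Longrightarrow> 0 < s_kappa \<kappa> t"
  by (auto simp: below_D_iff s_kappa_def intro!: sin_gt_zero divide_pos_pos mult_pos_pos)

lemma s_kappa_nonneg: "0 \<le> t \<Longrightarrow> below_D \<kappa> t \<Longrightarrow> 0 \<le> s_kappa \<kappa> t"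
  using s_kappa_pos[of t \<kappa>] by (cases "t = 0") auto

lemma c_kappa_pos: "below_D \<kappa> (2 * \<bar>t\<bar>) \<Longrightarrow> 0 < c_kappa \<kappa> t"
proof -
  assume *: "below_D \<kappa> (2 * \<bar>t\<bar>)"
  have "0 < cos (sqrt \<kappa> * \<bar>t\<bar>)" if "\<kappa> > 0"
  proof (rule cos_gt_zero_pi)
    show "sqrt \<kappa> * \<bar>t\<bar> < pi / 2" using * that by (auto simp: below_D_iff)
    show "- (pi / 2) < sqrt \<kappa> * \<bar>t\<bar>"
      using that by (smt (verit) mult_nonneg_nonneg pi_gt_zero real_sqrt_ge_zero divide_pos_pos)
  qed
  then have "0 < c_kappa \<kappa> \<bar>t\<bar>" by (cases "\<kappa> = 0") (auto simp: c_kappa_def)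
  then show ?thesis by (cases "t \<ge> 0") auto
qed

text \<open>Sum-to-product: the difference is twice \<open>c_kappa\<close> at the mean times
  \<open>s_kappa\<close> at half the difference. Only the sum is bounded, so \<open>x\<close> may
  lie beyond the maximum of \<open>s_kappa \<kappa>\<close>.\<close>

lemma s_kappa_mono:
  assumes "0 \<le> y" "y \<le> x" "below_D \<kappa> (x + y)"
  shows "s_kappa \<kappa> y \<le> s_kappa \<kappa> x"
proof -
  have x: "s_kappa \<kappa> x = s_kappa \<kappa> ((x + y) / 2 + (x - y) / 2)"
    and y: "s_kappa \<kappa> y = s_kappa \<kappa> ((x + y) / 2 - (x - y) / 2)"
    by (simp_all add: field_simps)
  have "s_kappa \<kappa> x - s_kappa \<kappa> y = 2 * (c_kappa \<kappa> ((x + y) / 2) * s_kappa \<kappa> ((x - y) / 2))"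
    unfolding x y s_kappa_add s_kappa_diff by simp
  moreover have "2 * \<bar>(x + y) / 2\<bar> = x + y" using assms by (simp add: abs_if)
  then have "0 < c_kappa \<kappa> ((x + y) / 2)"
    using assms(3) by (intro c_kappa_pos) (simp only:)
  moreover have "0 \<le> s_kappa \<kappa> ((x - y) / 2)"
    using assms(1,2) below_D_mono[OF assms(3), of "(x - y) / 2"] by (intro s_kappa_nonneg) auto
  ultimately show ?thesis
    using mult_nonneg_nonneg[of "c_kappa \<kappa> ((x + y) / 2)" "s_kappa \<kappa> ((x - y) / 2)"] by linarith
qed

text \<open>The bound is on the mean because in \<open>apex_parameter_exists\<close> the larger
  argument is a sum of two sides, which may exceed \<open>D_kappa \<kappa>\<close>, while the mean
  is half a perimeter.\<close>

lemma vers_kappa_mono: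
  assumes "0 \<le> y" "y \<le> x" "below_D \<kappa> ((x + y) / 2)"
  shows "vers_kappa \<kappa> y \<le> vers_kappa \<kappa> x"
proof -
  have "s_kappa \<kappa> (y / 2) \<le> s_kappa \<kappa> (x / 2)"
    using assms by (intro s_kappa_mono) (simp_all add: add_divide_distrib)
  moreover have "0 \<le> s_kappa \<kappa> (y / 2)"
    using assms(1,2) below_D_mono[OF assms(3), of "y / 2"] by (intro s_kappa_nonneg) auto
  ultimately show ?thesis by (simp add: vers_kappa_def power_mono)
qed

section \<open>Derivatives and the inverse function\<close>

lemma s_kappa_deriv: "(s_kappa \<kappa> has_real_derivative c_kappa \<kappa> t) (at t)"
proof -
  have "((\<lambda>t. sin (sqrt \<kappa> * t) / sqrt \<kappa>) has_real_derivative cos (sqrt \<kappa> * t)) (at t)" if "\<kappa> > 0"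
    using that by (auto intro!: derivative_eq_intros simp: mult.assoc)
  moreover have "((\<lambda>t. sinh (sqrt (-\<kappa>) * t) / sqrt (-\<kappa>)) has_real_derivative cosh (sqrt (-\<kappa>) * t)) (at t)" if "\<kappa> < 0"
    using that by (auto intro!: derivative_eq_intros simp: mult.assoc)
  ultimately show ?thesis
    unfolding s_kappa_def[abs_def] c_kappa_def
    by (cases "\<kappa> > 0"; cases "\<kappa> = 0") auto
qed

lemma vers_kappa_deriv: "(vers_kappa \<kappa> has_real_derivative s_kappa \<kappa> t) (at t)"
proof -
  have "((\<lambda>t. t / 2) has_real_derivative 1 / 2) (at t)" for t :: real
    by (auto intro!: derivative_eq_intros)
  from DERIV_chain'[OF this, where g = "s_kappa \<kappa>", OF s_kappa_deriv]
  have "((\<lambda>t. s_kappa \<kappa> (t / 2)) has_real_derivative c_kappa \<kappa> (t / 2) * (1 / 2)) (at t)" .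
  from DERIV_cmult[OF DERIV_power[OF this, of 2], of 2] show ?thesis
    using s_kappa_half[of \<kappa> t] by (simp add: vers_kappa_def[abs_def] mult_ac)
qed

lemma
  assumes "0 \<le> y" "\<kappa> * y \<le> 2"
  shows arc_kappa_nonneg: "0 \<le> arc_kappa \<kappa> y"
    and vers_arc_kappa: "vers_kappa \<kappa> (arc_kappa \<kappa> y) = y"
proof -
  show "0 \<le> arc_kappa \<kappa> y"
    using assms by (auto simp: arc_kappa_def arccos_lbound mult_nonpos_nonneg)
  have "c_kappa \<kappa> (arc_kappa \<kappa> y) = 1 - \<kappa> * y" if "\<kappa> \<noteq> 0"
    using that assms by (auto simp: arc_kappa_def c_kappa_def mult_nonpos_nonneg)
  then have "vers_kappa \<kappa> (arc_kappa \<kappa> y) = y" if "\<kappa> \<noteq> 0"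
    using that by (auto simp: c_kappa_vers)
  moreover have "vers_kappa \<kappa> (arc_kappa \<kappa> y) = y" if "\<kappa> = 0"
    using that assms by (simp add: vers_kappa_def arc_kappa_def s_kappa_def power_divide)
  ultimately show "vers_kappa \<kappa> (arc_kappa \<kappa> y) = y" by blast
qed

lemma arc_vers_kappa:
  assumes "0 \<le> t" "below_D \<kappa> t"
  shows "arc_kappa \<kappa> (vers_kappa \<kappa> t) = t"
proof -
  consider "\<kappa> > 0" | "\<kappa> = 0" | "\<kappa> < 0" by linarith
  then show ?thesis
  proof cases
    case 2
    with assms show ?thesis by (simp add: arc_kappa_def vers_kappa_def s_kappa_def power_divide)
  next
    case 1
    then have "1 - \<kappa> * vers_kappa \<kappa> t = cos (sqrt \<kappa> * t)"
      using c_kappa_vers[of \<kappa> t] by (simp add: c_kappa_def)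
    with assms 1 show ?thesis by (simp add: arc_kappa_def below_D_iff arccos_cos)
  next
    case 3
    then have "1 - \<kappa> * vers_kappa \<kappa> t = cosh (sqrt (-\<kappa>) * t)"
      using c_kappa_vers[of \<kappa> t] by (simp add: c_kappa_def)
    with assms 3 show ?thesis by (simp add: arc_kappa_def arcosh_cosh_real)
  qed
qed

text \<open>The inverse function rule: by \<open>s_kappa_squared_vers\<close> the root is
  \<open>s_kappa \<kappa> (arc_kappa \<kappa> y)\<close>, and \<open>s_kappa \<kappa>\<close> is the
  derivative of \<open>vers_kappa \<kappa>\<close>.\<close>

lemma arc_kappa_deriv:
  assumes "0 < y" "\<kappa> * y < 2"
  shows "(arc_kappa \<kappa> has_real_derivative 1 / sqrt (y * (2 - \<kappa> * y))) (at y)"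
proof -
  consider "\<kappa> > 0" | "\<kappa> = 0" | "\<kappa> < 0" by linarith
  then show ?thesis
  proof cases
    case 1
    have "1 - (1 - \<kappa> * y)\<^sup>2 = \<kappa> * (y * (2 - \<kappa> * y))" by (simp add: power2_eq_square algebra_simps)
    then have "sqrt \<kappa> * sqrt (y * (2 - \<kappa> * y)) = sqrt (1 - (1 - \<kappa> * y)\<^sup>2)"
      by (simp add: real_sqrt_mult)
    moreover have "0 < y * (2 - \<kappa> * y)" using assms by simp
    ultimately have "((\<lambda>y. arccos (1 - \<kappa> * y) / sqrt \<kappa>) has_real_derivative 1 / sqrt (y * (2 - \<kappa> * y))) (at y)"
      using 1 assms
      by (auto intro!: derivative_eq_intros simp: field_simps)
    with 1 show ?thesis by (simp add: arc_kappa_def[abs_def])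
  next
    case 2
    with assms have "((\<lambda>y. sqrt (2 * y)) has_real_derivative 1 / sqrt (y * (2 - \<kappa> * y))) (at y)"
      by (auto intro!: derivative_eq_intros simp: field_simps)
    with 2 show ?thesis by (simp add: arc_kappa_def[abs_def])
  next
    case 3
    have "(1 - \<kappa> * y)\<^sup>2 - 1 = (-\<kappa>) * (y * (2 - \<kappa> * y))" by (simp add: power2_eq_square algebra_simps)
    then have *: "sqrt (-\<kappa>) * sqrt (y * (2 - \<kappa> * y)) = sqrt ((1 - \<kappa> * y)\<^sup>2 - 1)"
      by (simp only: real_sqrt_mult)
    have "1 < 1 - \<kappa> * y" using assms 3 by (auto simp: mult_neg_pos)
    have "((\<lambda>y. 1 - \<kappa> * y) has_real_derivative - \<kappa>) (at y)"
      by (auto intro!: derivative_eq_intros)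
    from DERIV_chain'[OF this, where g = arcosh, OF arcosh_real_has_field_derivative[OF \<open>1 < 1 - \<kappa> * y\<close>]]
    have "((\<lambda>y. arcosh (1 - \<kappa> * y)) has_real_derivative
        1 / sqrt ((1 - \<kappa> * y)\<^sup>2 - 1) * - \<kappa>) (at y)" .
    from DERIV_cdivide[OF this, of "sqrt (-\<kappa>)"]
    have "((\<lambda>y. arcosh (1 - \<kappa> * y) / sqrt (-\<kappa>)) has_real_derivative
        1 / sqrt ((1 - \<kappa> * y)\<^sup>2 - 1) * - \<kappa> / sqrt (- \<kappa>)) (at y)" .
    also have "1 / sqrt ((1 - \<kappa> * y)\<^sup>2 - 1) * - \<kappa> / sqrt (- \<kappa>)
        = - \<kappa> / sqrt (- \<kappa>) / sqrt (- \<kappa>) / sqrt (y * (2 - \<kappa> * y))"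
      unfolding *[symmetric] by simp
    also have "- \<kappa> / sqrt (- \<kappa>) / sqrt (- \<kappa>) = 1"
      using 3 by (simp only: real_div_sqrt) simp
    finally have "((\<lambda>y. arcosh (1 - \<kappa> * y) / sqrt (-\<kappa>)) has_real_derivative
        1 / sqrt (y * (2 - \<kappa> * y))) (at y)" .
    with 3 show ?thesis by (simp add: arc_kappa_def[abs_def])
  qed
qed

text \<open>Includes the ends of the range, where differentiability fails, so that a minimum of the
  broken line exists even if it passes through an apex.\<close>

lemma arc_kappa_continuous: "continuous_on {y. 0 \<le> y \<and> \<kappa> * y \<le> 2} (arc_kappa \<kappa>)"
proof -
  consider "\<kappa> > 0" | "\<kappa> = 0" | "\<kappa> < 0" by linarith
  then show ?thesis
  proof cases
    case 1
    have "continuous_on {y. 0 \<le> y \<and> \<kappa> * y \<le> 2} (\<lambda>y. arccos (1 - \<kappa> * y) / sqrt \<kappa>)"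
      by (intro continuous_intros) (use 1 in auto)
    with 1 show ?thesis by (simp add: arc_kappa_def[abs_def])
  next
    case 2
    then show ?thesis by (auto simp: arc_kappa_def[abs_def] intro!: continuous_intros)
  next
    case 3
    have "continuous_on {y. 0 \<le> y \<and> \<kappa> * y \<le> 2} (\<lambda>y. arcosh (1 - \<kappa> * y) / sqrt (-\<kappa>))"
      by (intro continuous_intros) (use 3 in \<open>auto simp: mult_nonpos_nonneg\<close>)
    with 3 show ?thesis by (simp add: arc_kappa_def[abs_def])
  qed
qed


section \<open>Ptolemy's inequality for quadrilaterals in the model plane\<close>

text \<open>Two lines cross in a point at an angle with cosine \<open>k\<close>; \<open>t\<close>,
  \<open>t'\<close> and \<open>f\<close>, \<open>g\<close> are distances from it along the two
  lines, and the hypotheses are the laws of cosines for the four outer sides. Each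
  \<open>s_kappa\<close> of half a side is the modulus of a 2 by 2 complex determinant, which leaves
  the triangle inequality for complex numbers.\<close>

lemma ptolemy_crossing:
  fixes \<kappa> k t t' f g a b c e :: real
  assumes k: "\<bar>k\<bar> \<le> 1"
    and a: "vers_kappa \<kappa> a = vers_kappa \<kappa> t + vers_kappa \<kappa> f - \<kappa> * vers_kappa \<kappa> t * vers_kappa \<kappa> f - s_kappa \<kappa> t * (s_kappa \<kappa> f * k)"
    and b: "vers_kappa \<kappa> b = vers_kappa \<kappa> t' + vers_kappa \<kappa> f - \<kappa> * vers_kappa \<kappa> t' * vers_kappa \<kappa> f + s_kappa \<kappa> t' * (s_kappa \<kappa> f * k)"
    and e: "vers_kappa \<kappa> e = vers_kappa \<kappa> t + vers_kappa \<kappa> g - \<kappa> * vers_kappa \<kappa> t * vers_kappa \<kappa> g + s_kappa \<kappa> t * (s_kappa \<kappa> g * k)"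
    and c: "vers_kappa \<kappa> c = vers_kappa \<kappa> t' + vers_kappa \<kappa> g - \<kappa> * vers_kappa \<kappa> t' * vers_kappa \<kappa> g - s_kappa \<kappa> t' * (s_kappa \<kappa> g * k)"
    and nonneg: "0 \<le> s_kappa \<kappa> (a / 2)" "0 \<le> s_kappa \<kappa> (b / 2)" "0 \<le> s_kappa \<kappa> (c / 2)" "0 \<le> s_kappa \<kappa> (e / 2)"
  shows "s_kappa \<kappa> ((t + t') / 2) * s_kappa \<kappa> ((f + g) / 2)
    \<le> s_kappa \<kappa> (a / 2) * s_kappa \<kappa> (c / 2) + s_kappa \<kappa> (e / 2) * s_kappa \<kappa> (b / 2)"
proof -
  define v where "v = Complex k (sqrt (1 - k\<^sup>2))"
  have k2: "k\<^sup>2 \<le> 1" using k by (simp add: abs_square_le_1)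
  \<comment> \<open>The sign \<open>i\<close> separates the angle from its supplement. Since
    \<open>v\<close> has modulus 1 and real part \<open>k\<close>, expanding the squared modulus
    gives the law of cosines in half angles.\<close>
  have chord: "s_kappa \<kappa> (x / 2) = cmod (complex_of_real (s_kappa \<kappa> (r / 2) * c_kappa \<kappa> (r' / 2))
                 - complex_of_real (i * (s_kappa \<kappa> (r' / 2) * c_kappa \<kappa> (r / 2))) * v)"
    if x: "vers_kappa \<kappa> x = vers_kappa \<kappa> r + vers_kappa \<kappa> r' - \<kappa> * vers_kappa \<kappa> r * vers_kappa \<kappa> r'
         - i * (s_kappa \<kappa> r * (s_kappa \<kappa> r' * k))"
      and i: "i\<^sup>2 = 1" and s: "0 \<le> s_kappa \<kappa> (x / 2)" for i r r' x
  proof -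
    define S C S' C' where "S = s_kappa \<kappa> (r/2)" and "C = c_kappa \<kappa> (r/2)"
      and "S' = s_kappa \<kappa> (r'/2)" and "C' = c_kappa \<kappa> (r'/2)"
    have C: "C\<^sup>2 = 1 - \<kappa> * S\<^sup>2" "C'\<^sup>2 = 1 - \<kappa> * S'\<^sup>2"
      by (simp_all add: S_def C_def S'_def C'_def c_kappa_squared)
    have "(cmod (complex_of_real (S * C') - complex_of_real (i * (S' * C)) * v))\<^sup>2
        = (S * C' - i * (S' * C) * k)\<^sup>2 + (i * (S' * C))\<^sup>2 * (1 - k\<^sup>2)"
      using k2 by (simp add: cmod_power2 v_def power_mult_distrib)
    also have "\<dots> = S\<^sup>2 * C'\<^sup>2 + i\<^sup>2 * S'\<^sup>2 * C\<^sup>2 - 2 * i * S * C' * S' * C * k"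
      by (simp add: power2_eq_square algebra_simps)
    also have "\<dots> = (s_kappa \<kappa> (x / 2))\<^sup>2"
      using x unfolding i C s_kappa_half[of \<kappa> r] s_kappa_half[of \<kappa> r'] vers_kappa_def
      by (fold S_def C_def S'_def C'_def) (simp add: algebra_simps)
    finally show ?thesis
      using s by (simp add: S_def C_def S'_def C'_def power2_eq_iff_nonneg)
  qed
  define T C\<^sub>t T' C\<^sub>t' F C\<^sub>f G C\<^sub>g where "T = s_kappa \<kappa> (t/2)" and "C\<^sub>t = c_kappa \<kappa> (t/2)"
    and "T' = s_kappa \<kappa> (t'/2)" and "C\<^sub>t' = c_kappa \<kappa> (t'/2)"
    and "F = s_kappa \<kappa> (f/2)" and "C\<^sub>f = c_kappa \<kappa> (f/2)"
    and "G = s_kappa \<kappa> (g/2)" and "C\<^sub>g = c_kappa \<kappa> (g/2)"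
  note defs = T_def C\<^sub>t_def T'_def C\<^sub>t'_def F_def C\<^sub>f_def G_def C\<^sub>g_def
  let ?r = complex_of_real
  have A: "s_kappa \<kappa> (a / 2) = cmod (?r (T * C\<^sub>f) - ?r (1 * (F * C\<^sub>t)) * v)"
    unfolding defs by (rule chord) (use a nonneg in simp_all)
  have B: "s_kappa \<kappa> (b / 2) = cmod (?r (T' * C\<^sub>f) - ?r (-1 * (F * C\<^sub>t')) * v)"
    unfolding defs by (rule chord) (use b nonneg in simp_all)
  have C: "s_kappa \<kappa> (c / 2) = cmod (?r (T' * C\<^sub>g) - ?r (1 * (G * C\<^sub>t')) * v)"
    unfolding defs by (rule chord) (use c nonneg in simp_all)
  have E: "s_kappa \<kappa> (e / 2) = cmod (?r (T * C\<^sub>g) - ?r (-1 * (G * C\<^sub>t)) * v)"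
    unfolding defs by (rule chord) (use e nonneg in simp_all)
  have "cmod v = 1" using k2 by (simp add: cmod_def v_def)
  \<comment> \<open>The Pluecker relation for the four points \<open>T : C\<^sub>t\<close>, \<open>F v : C\<^sub>f\<close>, \<open>-T' : C\<^sub>t'\<close>, \<open>-G v : C\<^sub>g\<close>
     of the complex projective line.\<close>
  have "(T * C\<^sub>t' + C\<^sub>t * T') * (F * C\<^sub>g + C\<^sub>f * G) \<le> cmod (?r ((T * C\<^sub>t' + C\<^sub>t * T') * (F * C\<^sub>g + C\<^sub>f * G)) * v)"
    using \<open>cmod v = 1\<close> by (simp add: norm_mult del: of_real_mult of_real_add)
  also have "?r ((T * C\<^sub>t' + C\<^sub>t * T') * (F * C\<^sub>g + C\<^sub>f * G)) * v
     = (?r (T * C\<^sub>g) - ?r (-1 * (G * C\<^sub>t)) * v) * (?r (T' * C\<^sub>f) - ?r (-1 * (F * C\<^sub>t')) * v)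
       - (?r (T * C\<^sub>f) - ?r (1 * (F * C\<^sub>t)) * v) * (?r (T' * C\<^sub>g) - ?r (1 * (G * C\<^sub>t')) * v)"
    by (simp add: algebra_simps)
  also have "cmod \<dots> \<le> s_kappa \<kappa> (e / 2) * s_kappa \<kappa> (b / 2) + s_kappa \<kappa> (a / 2) * s_kappa \<kappa> (c / 2)"
    unfolding A B C E norm_mult[symmetric] by (rule norm_triangle_ineq4)
  finally show ?thesis
    by (simp add: add_divide_distrib s_kappa_add defs)
qed

text \<open>For \<kappa> = 0 this is the factorization of
  \<open>\<sigma>\<^sup>2 - (\<alpha> - \<epsilon>)\<^sup>2\<close>. The product form reveals the
  sign needed in \<open>ptolemy_reflex\<close>.\<close>

lemma quadrilateral_factorization:
  fixes \<kappa> \<alpha> \<epsilon> \<sigma> :: real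
  shows "(s_kappa \<kappa> \<sigma>)\<^sup>2 + 2 * s_kappa \<kappa> \<alpha> * s_kappa \<kappa> \<epsilon> * c_kappa \<kappa> \<sigma> - (s_kappa \<kappa> \<alpha>)\<^sup>2 - (s_kappa \<kappa> \<epsilon>)\<^sup>2
    = 4 * s_kappa \<kappa> ((\<sigma> + \<alpha> - \<epsilon>) / 2) * s_kappa \<kappa> ((\<sigma> - \<alpha> + \<epsilon>) / 2)
        * c_kappa \<kappa> ((\<sigma> + \<alpha> + \<epsilon>) / 2) * c_kappa \<kappa> ((\<alpha> + \<epsilon> - \<sigma>) / 2)"
proof -
  \<comment> \<open>In these variables all arguments are sums, and the addition formulas leave a
    polynomial identity modulo the three relations between \<open>c_kappa\<close> and
    \<open>s_kappa\<close>.\<close>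
  define x y z where "x = (\<sigma> + \<alpha> - \<epsilon>) / 2" and "y = (\<sigma> - \<alpha> + \<epsilon>) / 2" and "z = (\<alpha> + \<epsilon> - \<sigma>) / 2"
  have *: "\<sigma> = x + y" "\<alpha> = x + z" "\<epsilon> = y + z" "(\<sigma> + \<alpha> + \<epsilon>) / 2 = x + y + z"
    by (simp_all add: x_def y_def z_def field_simps)
  have "(c_kappa \<kappa> x)\<^sup>2 = 1 - \<kappa> * (s_kappa \<kappa> x)\<^sup>2" "(c_kappa \<kappa> y)\<^sup>2 = 1 - \<kappa> * (s_kappa \<kappa> y)\<^sup>2"
    "(c_kappa \<kappa> z)\<^sup>2 = 1 - \<kappa> * (s_kappa \<kappa> z)\<^sup>2"
    by (rule c_kappa_squared)+
  then show ?thesis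
    unfolding *(4) x_def[symmetric] y_def[symmetric] z_def[symmetric]
    unfolding *(1-3) s_kappa_add c_kappa_add
    by algebra
qed

text \<open>The hypothesis \<open>angle\<close> says that the angles at the third vertex of the triangles with sides
  \<open>a, b, L\<close> and \<open>e, c, L\<close> add up to at least \<open>\<pi>\<close>.\<close>

lemma ptolemy_reflex:
  fixes \<kappa> a b c e L :: real
  assumes angle: "(vers_kappa \<kappa> L + vers_kappa \<kappa> b - \<kappa> * vers_kappa \<kappa> L * vers_kappa \<kappa> b - vers_kappa \<kappa> a) * s_kappa \<kappa> c
      + (vers_kappa \<kappa> L + vers_kappa \<kappa> c - \<kappa> * vers_kappa \<kappa> L * vers_kappa \<kappa> c - vers_kappa \<kappa> e) * s_kappa \<kappa> b \<le> 0"
    and nonneg: "0 \<le> a" "0 \<le> b" "0 \<le> c" "0 \<le> e"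
    and triangle: "a \<le> b + c + e" "e \<le> a + b + c"
    and short: "b + c \<le> a + e"
    and perimeter: "below_D \<kappa> ((a + b + c + e) / 2)"
  shows "s_kappa \<kappa> (L / 2) * s_kappa \<kappa> ((b + c) / 2)
    \<le> s_kappa \<kappa> (a / 2) * s_kappa \<kappa> (c / 2) + s_kappa \<kappa> (e / 2) * s_kappa \<kappa> (b / 2)"
proof -
  define A B C E \<Lambda> B' C' S S' where "A = s_kappa \<kappa> (a/2)" and "B = s_kappa \<kappa> (b/2)"
    and "C = s_kappa \<kappa> (c/2)" and "E = s_kappa \<kappa> (e/2)" and "\<Lambda> = s_kappa \<kappa> (L/2)"
    and "B' = c_kappa \<kappa> (b/2)" and "C' = c_kappa \<kappa> (c/2)"
    and "S = s_kappa \<kappa> ((b+c)/2)" and "S' = c_kappa \<kappa> ((b+c)/2)"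
  note defs = A_def B_def C_def E_def \<Lambda>_def B'_def C'_def S_def S'_def
  have below: "below_D \<kappa> u" if "u \<le> (a + b + c + e) / 2" for u
    using below_D_mono[OF perimeter that] .
  have nn: "0 \<le> A" "0 \<le> B" "0 \<le> C" "0 \<le> E" "0 \<le> S"
    unfolding defs using nonneg by (auto intro!: s_kappa_nonneg below)
  \<comment> \<open>By \<open>short\<close>, \<open>b + c\<close> is at most half the
    perimeter.\<close>
  have S'_pos: "0 < S'"
    unfolding defs using nonneg short by (auto intro!: c_kappa_pos below)
  have S: "S = B * C' + B' * C" and S': "S' = B' * C' - \<kappa> * B * C"
    unfolding defs add_divide_distrib by (rule s_kappa_add c_kappa_add)+
  have sq: "B'\<^sup>2 = 1 - \<kappa> * B\<^sup>2" "C'\<^sup>2 = 1 - \<kappa> * C\<^sup>2"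
    unfolding defs by (rule c_kappa_squared)+
  have "(2 * \<Lambda>\<^sup>2 + 2 * B\<^sup>2 - \<kappa> * (2 * \<Lambda>\<^sup>2) * (2 * B\<^sup>2) - 2 * A\<^sup>2) * (2 * C * C')
      + (2 * \<Lambda>\<^sup>2 + 2 * C\<^sup>2 - \<kappa> * (2 * \<Lambda>\<^sup>2) * (2 * C\<^sup>2) - 2 * E\<^sup>2) * (2 * B * B') \<le> 0"
    using angle unfolding vers_kappa_def s_kappa_half[of \<kappa> b] s_kappa_half[of \<kappa> c] defs .
  moreover have "(2 * \<Lambda>\<^sup>2 + 2 * B\<^sup>2 - \<kappa> * (2 * \<Lambda>\<^sup>2) * (2 * B\<^sup>2) - 2 * A\<^sup>2) * (2 * C * C')
      + (2 * \<Lambda>\<^sup>2 + 2 * C\<^sup>2 - \<kappa> * (2 * \<Lambda>\<^sup>2) * (2 * C\<^sup>2) - 2 * E\<^sup>2) * (2 * B * B')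
      = 4 * (\<Lambda>\<^sup>2 * S * S' - (A\<^sup>2 * C * C' + E\<^sup>2 * B * B' - S * B * C))"
    using sq unfolding S S' by algebra
  \<comment> \<open>The angle condition in half angles, read as an upper bound for
    \<open>\<Lambda>\<^sup>2\<close>. Identity \<open>2\<close> then compares this bound, multiplied
    by \<open>S\<close>, with the square of the desired right side.\<close>
  ultimately have 1: "\<Lambda>\<^sup>2 * S * S' \<le> A\<^sup>2 * C * C' + E\<^sup>2 * B * B' - S * B * C" by simp
  have 2: "S' * (A * C + E * B)\<^sup>2 - S * (A\<^sup>2 * C * C' + E\<^sup>2 * B * B' - S * B * C)
      = B * C * (S\<^sup>2 + 2 * A * E * S' - A\<^sup>2 - E\<^sup>2)"
    using sq unfolding S S' by algebra
  \<comment> \<open>The \<open>s_kappa\<close> factors are nonnegative by \<open>triangle\<close>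
    and \<open>short\<close>, the \<open>c_kappa\<close> factors positive by the bound on the
    perimeter.\<close>
  have "0 \<le> S\<^sup>2 + 2 * A * E * S' - A\<^sup>2 - E\<^sup>2"
    unfolding defs quadrilateral_factorization
    using nonneg triangle short
    by (intro mult_nonneg_nonneg s_kappa_nonneg below c_kappa_pos[THEN less_imp_le])
      (simp_all add: add_divide_distrib diff_divide_distrib abs_if)
  with nn have "0 \<le> B * C * (S\<^sup>2 + 2 * A * E * S' - A\<^sup>2 - E\<^sup>2)" by simp
  with 2 have "S * (A\<^sup>2 * C * C' + E\<^sup>2 * B * B' - S * B * C) \<le> S' * (A * C + E * B)\<^sup>2" by simp
  moreover have "S * (\<Lambda>\<^sup>2 * S * S') \<le> S * (A\<^sup>2 * C * C' + E\<^sup>2 * B * B' - S * B * C)"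
    using 1 nn by (intro mult_left_mono) auto
  ultimately have "S' * (\<Lambda> * S)\<^sup>2 \<le> S' * (A * C + E * B)\<^sup>2"
    by (simp add: power2_eq_square mult_ac)
  with S'_pos have "(\<Lambda> * S)\<^sup>2 \<le> (A * C + E * B)\<^sup>2" by simp
  then have "\<Lambda> * S \<le> A * C + E * B"
    by (rule power2_le_imp_le) (use nn in auto)
  then show ?thesis unfolding defs .
qed


section \<open>Comparison triangles\<close>

definition model_prod :: "real \<Rightarrow> (nat \<Rightarrow> real) \<Rightarrow> (nat \<Rightarrow> real) \<Rightarrow> real" where
  "model_prod \<kappa> x y = (if \<kappa> > 0 then inner_prod 2 x y else lorentz_prod 2 x y)"

text \<open>On the model plane this is half the square of \<open>x - y\<close> in the ambient form,
  and equals \<open>vers_kappa \<kappa>\<close> of the distance. Distances thus become polynomial in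
  the coordinates for every \<kappa>.\<close>

definition chord_kappa :: "real \<Rightarrow> (nat \<Rightarrow> real) \<Rightarrow> (nat \<Rightarrow> real) \<Rightarrow> real" where
  "chord_kappa \<kappa> x y =
     (if \<kappa> = 0 then ((x 0 - y 0)\<^sup>2 + (x 1 - y 1)\<^sup>2) / 2 else (1 - \<kappa> * model_prod \<kappa> x y) / \<kappa>)"

lemma model_prod_eq:
  "model_prod \<kappa> x y = (if \<kappa> > 0 then 1 else -1) * (x 0 * y 0) + x 1 * y 1 + x 2 * y 2"
proof -
  have "{0..2} = {0, 1, 2 :: nat}" "{1..2} = {1, 2 :: nat}" by auto
  then show ?thesis by (simp add: model_prod_def inner_prod_def lorentz_prod_def)
qed

lemma chord_kappa_commute: "chord_kappa \<kappa> x y = chord_kappa \<kappa> y x"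
  by (simp add: chord_kappa_def model_prod_eq mult.commute power2_commute)

lemma model_dist_chord: "model_dist \<kappa> 2 x y = arc_kappa \<kappa> (chord_kappa \<kappa> x y)"
proof -
  have "{..<2} = {0, 1 :: nat}" by auto
  then show ?thesis
    by (simp add: model_dist_def arc_kappa_def chord_kappa_def model_prod_def L2_set_def)
qed

text \<open>With the quadric written as a vanishing chord, a distance formula along a curve, taken
  at equal parameters, also yields membership.\<close>

lemma model_space_iff:
  "x \<in> model_space \<kappa> 2 \<longleftrightarrow>
     (if \<kappa> = 0 then \<forall>i\<ge>2. x i = 0
      else (\<forall>i\<ge>3. x i = 0) \<and> chord_kappa \<kappa> x x = 0 \<and> (\<kappa> < 0 \<longrightarrow> x 0 > 0))"
proof -
  have "chord_kappa \<kappa> x x = 0 \<longleftrightarrow> model_prod \<kappa> x x = 1 / \<kappa>" if "\<kappa> \<noteq> 0"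
    using that by (auto simp: chord_kappa_def field_simps)
  then show ?thesis
    by (auto simp: model_space_def model_prod_def topspace_Euclidean_space)
qed

text \<open>Spherical linear interpolation with its flat and hyperbolic analogues: the unit speed
  geodesic between two points at distance \<open>l\<close>.\<close>

definition model_line :: "real \<Rightarrow> real \<Rightarrow> (nat \<Rightarrow> real) \<Rightarrow> (nat \<Rightarrow> real) \<Rightarrow> real \<Rightarrow> nat \<Rightarrow> real" where
  "model_line \<kappa> l x y s = (\<lambda>i. (s_kappa \<kappa> (l - s) * x i + s_kappa \<kappa> s * y i) / s_kappa \<kappa> l)"

lemma chord_model_line:
  assumes "x \<in> model_space \<kappa> 2" "y \<in> model_space \<kappa> 2" and xy: "chord_kappa \<kappa> x y = vers_kappa \<kappa> l"
    and l: "s_kappa \<kappa> l \<noteq> 0"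
  shows "chord_kappa \<kappa> (model_line \<kappa> l x y s) (model_line \<kappa> l x y s') = vers_kappa \<kappa> (s - s')"
proof (cases "\<kappa> = 0")
  case True
  with l have "l \<noteq> 0" by (auto simp: s_kappa_def)
  then have *: "model_line \<kappa> l x y s i - model_line \<kappa> l x y s' i = (s - s') / l * (y i - x i)" for i
    using True by (simp add: model_line_def s_kappa_def field_simps)
  have "chord_kappa \<kappa> (model_line \<kappa> l x y s) (model_line \<kappa> l x y s') = ((s - s') / l)\<^sup>2 * chord_kappa \<kappa> x y"
    unfolding chord_kappa_def * power_mult_distrib power2_commute[of "y _"] using True
    by (simp add: distrib_left add_divide_distrib)
  with True \<open>l \<noteq> 0\<close> show ?thesis
    unfolding xy by (simp add: vers_kappa_def s_kappa_def power_divide power2_commute)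
next
  case False
  have xx: "\<kappa> * model_prod \<kappa> x x = 1" "\<kappa> * model_prod \<kappa> y y = 1"
    and xy: "\<kappa> * model_prod \<kappa> x y = c_kappa \<kappa> l"
    using assms False by (auto simp: model_space_iff chord_kappa_def c_kappa_vers field_simps)
  define S\<^sub>l C\<^sub>l S C S' C' where "S\<^sub>l = s_kappa \<kappa> l" and "C\<^sub>l = c_kappa \<kappa> l"
    and "S = s_kappa \<kappa> s" and "C = c_kappa \<kappa> s" and "S' = s_kappa \<kappa> s'" and "C' = c_kappa \<kappa> s'"
  note defs = S\<^sub>l_def C\<^sub>l_def S_def C_def S'_def C'_def
  have sq: "C\<^sub>l\<^sup>2 = 1 - \<kappa> * S\<^sub>l\<^sup>2" "C\<^sup>2 = 1 - \<kappa> * S\<^sup>2" "C'\<^sup>2 = 1 - \<kappa> * S'\<^sup>2"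
    by (simp_all add: defs c_kappa_squared)
  let ?u = "S\<^sub>l * C - C\<^sub>l * S" and ?u' = "S\<^sub>l * C' - C\<^sub>l * S'"
  have "\<kappa> * model_prod \<kappa> (model_line \<kappa> l x y s) (model_line \<kappa> l x y s')
      = (?u * ?u' * (\<kappa> * model_prod \<kappa> x x) + (?u * S' + S * ?u') * (\<kappa> * model_prod \<kappa> x y)
          + S * S' * (\<kappa> * model_prod \<kappa> y y)) / S\<^sub>l\<^sup>2"
    using l unfolding model_line_def s_kappa_diff model_prod_eq
    by (fold defs) (simp add: field_simps power2_eq_square)
  also have "\<dots> = (?u * ?u' + (?u * S' + S * ?u') * C\<^sub>l + S * S') / S\<^sub>l\<^sup>2"
    unfolding xx xy by (simp add: defs)
  also have "?u * ?u' + (?u * S' + S * ?u') * C\<^sub>l + S * S' = S\<^sub>l\<^sup>2 * (C * C' + \<kappa> * S * S')"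
    using sq by algebra
  also have "\<dots> / S\<^sub>l\<^sup>2 = c_kappa \<kappa> (s - s')"
    using l by (simp add: c_kappa_diff defs)
  finally show ?thesis
    using False by (simp add: chord_kappa_def c_kappa_vers)
qed

lemma geodesic_segment_model_line:
  assumes x: "x \<in> model_space \<kappa> 2" and y: "y \<in> model_space \<kappa> 2"
    and xy: "chord_kappa \<kappa> x y = vers_kappa \<kappa> l" and l: "0 < l" "below_D \<kappa> l"
  shows "geodesic_segment (model_space \<kappa> 2) (model_dist \<kappa> 2) x y (model_line \<kappa> l x y ` {0..l})"
proof -
  have l': "0 < s_kappa \<kappa> l" using l by (rule s_kappa_pos)
  note chord = chord_model_line[OF x y xy less_imp_neq[OF l', symmetric]]
  have "model_line \<kappa> l x y s \<in> model_space \<kappa> 2" if s: "s \<in> {0..l}" for s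
  proof -
    \<comment> \<open>The hyperboloid has two sheets; a combination with nonnegative coefficients,
      not both zero, stays on the upper one.\<close>
    have "0 < model_line \<kappa> l x y s 0" if "\<kappa> < 0"
    proof -
      have "below_D \<kappa> r" for r using that by (simp add: below_D_iff)
      then have "0 \<le> s_kappa \<kappa> s" "0 \<le> s_kappa \<kappa> (l - s)" "0 < s \<Longrightarrow> 0 < s_kappa \<kappa> s"
        using s by (auto intro: s_kappa_nonneg s_kappa_pos)
      moreover have "0 < x 0" "0 < y 0" using that x y by (auto simp: model_space_iff)
      ultimately show ?thesis
        using l' s unfolding model_line_def
        by (cases "s = 0") (auto intro!: divide_pos_pos add_nonneg_pos)
    qed
    then show ?thesis
      using x y chord[of s s] by (auto simp: model_space_iff model_line_def)
  qed
  moreover have "model_dist \<kappa> 2 (model_line \<kappa> l x y s) (model_line \<kappa> l x y s') = \<bar>s - s'\<bar>"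
    if "s \<in> {0..l}" "s' \<in> {0..l}" for s s'
  proof -
    have "vers_kappa \<kappa> (s - s') = vers_kappa \<kappa> \<bar>s - s'\<bar>"
      using vers_kappa_minus[of \<kappa> "s - s'"] by (simp add: abs_if)
    moreover have "below_D \<kappa> \<bar>s - s'\<bar>"
      by (rule below_D_mono[OF l(2)]) (use that in auto)
    ultimately show ?thesis
      by (simp add: model_dist_chord chord arc_vers_kappa)
  qed
  moreover have "model_line \<kappa> l x y 0 = x" "model_line \<kappa> l x y l = y"
    using l' by (auto simp: model_line_def)
  ultimately show ?thesis
    unfolding geodesic_segment_def using l(1)
    by (intro exI[of _ "model_line \<kappa> l x y"] exI[of _ l]) auto
qed

text \<open>For \<open>\<kappa> = 0\<close> the ambient plane has only two coordinates and \<open>w\<close> is dropped.\<close>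

definition model_point :: "real \<Rightarrow> real \<Rightarrow> real \<Rightarrow> real \<Rightarrow> nat \<Rightarrow> real" where
  "model_point \<kappa> w u v =
     (if \<kappa> = 0 then (\<lambda>i. if i = 0 then u else if i = 1 then v else 0)
      else (\<lambda>i. if i = 0 then w / sqrt \<bar>\<kappa>\<bar> else if i = 1 then u else if i = 2 then v else 0))"

lemma chord_model_point:
  "chord_kappa \<kappa> (model_point \<kappa> w u v) (model_point \<kappa> w' u' v') =
     (if \<kappa> = 0 then ((u - u')\<^sup>2 + (v - v')\<^sup>2) / 2 else (1 - w * w' - \<kappa> * (u * u' + v * v')) / \<kappa>)"
proof -
  have "\<bar>\<kappa>\<bar> = (if \<kappa> > 0 then \<kappa> else - \<kappa>)" by auto
  then have "\<kappa> * model_prod \<kappa> (model_point \<kappa> w u v) (model_point \<kappa> w' u' v') = w * w' + \<kappa> * (u * u' + v * v')"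
    if "\<kappa> \<noteq> 0"
    using that by (simp add: model_prod_eq model_point_def algebra_simps)
  then show ?thesis by (auto simp: chord_kappa_def model_point_def)
qed

lemma model_point_mem:
  assumes "w\<^sup>2 + \<kappa> * (u\<^sup>2 + v\<^sup>2) = 1" "\<kappa> < 0 \<Longrightarrow> w > 0"
  shows "model_point \<kappa> w u v \<in> model_space \<kappa> 2"
  using assms chord_model_point[of \<kappa> w u v w u v]
  by (auto simp: model_space_iff power2_eq_square model_point_def)

text \<open>Explicit coordinates: the base is \<open>m\<close>, starting at \<open>x\<close>, and
  the apex lies at distance \<open>a\<close> from \<open>x\<close> with \<open>q\<close> and
  \<open>h\<close> equal to \<open>s_kappa \<kappa> a\<close> times the cosine and sine of the angle
  there. The hypothesis on \<open>q\<close> makes \<open>h\<close> real.\<close>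

lemma comparison_triangle_exists:
  assumes pos: "0 < a" "0 < b" "0 < L" and below: "below_D \<kappa> a" "below_D \<kappa> b" "below_D \<kappa> L"
    and q: "q\<^sup>2 \<le> (s_kappa \<kappa> a)\<^sup>2"
    and b: "vers_kappa \<kappa> b = vers_kappa \<kappa> a + vers_kappa \<kappa> L - \<kappa> * vers_kappa \<kappa> a * vers_kappa \<kappa> L - s_kappa \<kappa> L * q"
  obtains x y z A B C m where
    "geodesic_triangle (model_space \<kappa> 2) (model_dist \<kappa> 2) x y z A B C"
    "model_dist \<kappa> 2 x y = L" "model_dist \<kappa> 2 y z = b" "model_dist \<kappa> 2 z x = a"
    "\<And>t. t \<in> {0..L} \<Longrightarrow> m t \<in> A \<and> model_dist \<kappa> 2 (m t) x = t \<and>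
       model_dist \<kappa> 2 z (m t) = arc_kappa \<kappa> (vers_kappa \<kappa> a + vers_kappa \<kappa> t - \<kappa> * vers_kappa \<kappa> a * vers_kappa \<kappa> t - s_kappa \<kappa> t * q)"
proof -
  define h where "h = sqrt ((s_kappa \<kappa> a)\<^sup>2 - q\<^sup>2)"
  define z where "z = model_point \<kappa> (c_kappa \<kappa> a) q h"
  define m where "m t = model_point \<kappa> (c_kappa \<kappa> t) (s_kappa \<kappa> t) 0" for t
  have h: "q\<^sup>2 + h\<^sup>2 = (s_kappa \<kappa> a)\<^sup>2" using q by (simp add: h_def)
  have cs_pos: "0 < c_kappa \<kappa> t" if "\<kappa> < 0" for t
    by (rule c_kappa_pos) (use that in \<open>simp add: below_D_iff\<close>)
  have mem: "z \<in> model_space \<kappa> 2" "m t \<in> model_space \<kappa> 2" for t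
    unfolding z_def m_def by (rule model_point_mem; simp add: h c_kappa_squared cs_pos)+
  have mm: "chord_kappa \<kappa> (m s) (m t) = vers_kappa \<kappa> (t - s)" for s t
  proof (cases "\<kappa> = 0")
    case False
    then show ?thesis
      using c_kappa_diff[of \<kappa> t s] c_kappa_vers[of \<kappa> "t - s"]
      by (simp add: m_def chord_model_point field_simps)
  qed (simp add: m_def chord_model_point vers_kappa_def s_kappa_def power_divide power2_commute)
  have zm: "chord_kappa \<kappa> z (m t) = vers_kappa \<kappa> a + vers_kappa \<kappa> t - \<kappa> * vers_kappa \<kappa> a * vers_kappa \<kappa> t - s_kappa \<kappa> t * q" for t
  proof (cases "\<kappa> = 0")
    case True
    with h have "q\<^sup>2 + h\<^sup>2 = a\<^sup>2" by (simp add: s_kappa_def)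
    then have "(q - t)\<^sup>2 + h\<^sup>2 = a\<^sup>2 + t\<^sup>2 - 2 * t * q"
      by (simp add: power2_diff)
    with True show ?thesis
      by (simp add: z_def m_def chord_model_point vers_kappa_def s_kappa_def field_simps)
  next
    case False
    then show ?thesis
      by (simp add: z_def m_def chord_model_point c_kappa_vers field_simps)
  qed
  have ends: "chord_kappa \<kappa> (m 0) (m L) = vers_kappa \<kappa> L" "chord_kappa \<kappa> (m L) z = vers_kappa \<kappa> b"
    "chord_kappa \<kappa> z (m 0) = vers_kappa \<kappa> a"
    using b by (simp_all add: mm zm chord_kappa_commute[of _ _ z])
  have sL: "s_kappa \<kappa> L \<noteq> 0" using s_kappa_pos[of L \<kappa>] pos below by simp
  \<comment> \<open>Identifies the base segment with the curve \<open>m\<close>, so that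
    \<open>m t\<close> lies on it. The divisor \<open>w\<close> below absorbs the scaling of
    coordinate 0 in \<open>model_point\<close>.\<close>
  have line: "model_line \<kappa> L (m 0) (m L) t = m t" for t
  proof -
    have "(s_kappa \<kappa> (L - t) + s_kappa \<kappa> t * c_kappa \<kappa> L) / s_kappa \<kappa> L = c_kappa \<kappa> t"
      using sL by (simp add: s_kappa_diff field_simps)
    then have "(s_kappa \<kappa> (L - t) * (1 / w) + s_kappa \<kappa> t * (c_kappa \<kappa> L / w)) / s_kappa \<kappa> L = c_kappa \<kappa> t / w" for w
      by (metis (no_types, lifting) add_divide_distrib divide_divide_eq_left mult.commute mult.right_neutral times_divide_eq_right)
    then show ?thesis
      using sL by (auto simp: model_line_def m_def model_point_def fun_eq_iff)
  qed
  show thesis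
  proof (rule that)
    show "geodesic_triangle (model_space \<kappa> 2) (model_dist \<kappa> 2) (m 0) (m L) z
        (model_line \<kappa> L (m 0) (m L) ` {0..L}) (model_line \<kappa> b (m L) z ` {0..b}) (model_line \<kappa> a z (m 0) ` {0..a})"
      unfolding geodesic_triangle_def
      using mem ends pos below by (auto intro!: geodesic_segment_model_line)
    show "model_dist \<kappa> 2 (m 0) (m L) = L" "model_dist \<kappa> 2 (m L) z = b" "model_dist \<kappa> 2 z (m 0) = a"
      using pos below by (simp_all add: model_dist_chord ends arc_vers_kappa)
    show "m t \<in> model_line \<kappa> L (m 0) (m L) ` {0..L} \<and> model_dist \<kappa> 2 (m t) (m 0) = t \<and>
        model_dist \<kappa> 2 z (m t) = arc_kappa \<kappa> (vers_kappa \<kappa> a + vers_kappa \<kappa> t - \<kappa> * vers_kappa \<kappa> a * vers_kappa \<kappa> t - s_kappa \<kappa> t * q)"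
      if "t \<in> {0..L}" for t
      using that below_D_mono[OF below(3), of t]
      by (auto simp: line model_dist_chord mm zm arc_vers_kappa)
  qed
qed

section \<open>Comparison of distances from an apex to the opposite side\<close>

lemma geodesic_segment_ends:
  assumes "geodesic_segment X d x y S"
  shows "x \<in> S" "y \<in> S"
  using assms unfolding geodesic_segment_def by auto

text \<open>\<open>CAT\<close> quantifies over all comparison triangles, so one must be exhibited.
  In the one constructed above, \<open>m t\<close> is a comparison point for \<open>c t\<close> and
  the apex \<open>z'\<close> one for \<open>z\<close>.\<close>

lemma CAT_dist_le:
  assumes CAT: "CAT \<kappa> X d" and X: "c 0 \<in> X" "c L \<in> X" "z \<in> X"
    and c: "c ` {0..L} \<subseteq> X" "\<And>s t. s \<in> {0..L} \<Longrightarrow> t \<in> {0..L} \<Longrightarrow> d (c s) (c t) = \<bar>s - t\<bar>"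
    and pos: "0 < d (c 0) z" "0 < d z (c L)" "0 < L"
    and perimeter: "below_D \<kappa> ((d (c 0) z + d z (c L) + L) / 2)"
    and q: "q\<^sup>2 \<le> (s_kappa \<kappa> (d (c 0) z))\<^sup>2"
    and b: "vers_kappa \<kappa> (d z (c L)) = vers_kappa \<kappa> (d (c 0) z) + vers_kappa \<kappa> L
        - \<kappa> * vers_kappa \<kappa> (d (c 0) z) * vers_kappa \<kappa> L - s_kappa \<kappa> L * q"
    and t: "t \<in> {0..L}"
  shows "d z (c t) \<le> arc_kappa \<kappa> (vers_kappa \<kappa> (d (c 0) z) + vers_kappa \<kappa> t
        - \<kappa> * vers_kappa \<kappa> (d (c 0) z) * vers_kappa \<kappa> t - s_kappa \<kappa> t * q)"
proof -
  have geo: "geodesic_metric_space X d" using CAT by (simp add: CAT_def)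
  then interpret Metric_space X d by (simp add: geodesic_metric_space_def)
  have L: "d (c 0) (c L) = L" using c(2)[of 0 L] pos by simp
  have "L \<le> d (c 0) z + d z (c L)" "d (c 0) z \<le> L + d z (c L)" "d z (c L) \<le> d (c 0) z + L"
    using triangle[of "c 0" z "c L"] triangle[of "c 0" "c L" z] triangle[of z "c 0" "c L"] X L
    by (simp_all add: commute)
  \<comment> \<open>By the triangle inequalities each side is at most half the perimeter.\<close>
  then have below: "below_D \<kappa> (d (c 0) z)" "below_D \<kappa> (d z (c L))" "below_D \<kappa> L"
    by (auto intro!: below_D_mono[OF perimeter])
  obtain x' y' z' A' B' C' m where tri': "geodesic_triangle (model_space \<kappa> 2) (model_dist \<kappa> 2) x' y' z' A' B' C'"
    and dist': "model_dist \<kappa> 2 x' y' = L" "model_dist \<kappa> 2 y' z' = d z (c L)" "model_dist \<kappa> 2 z' x' = d (c 0) z"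
    and m: "\<And>t. t \<in> {0..L} \<Longrightarrow> m t \<in> A' \<and> model_dist \<kappa> 2 (m t) x' = t \<and>
       model_dist \<kappa> 2 z' (m t) = arc_kappa \<kappa> (vers_kappa \<kappa> (d (c 0) z) + vers_kappa \<kappa> t
        - \<kappa> * vers_kappa \<kappa> (d (c 0) z) * vers_kappa \<kappa> t - s_kappa \<kappa> t * q)"
    using comparison_triangle_exists[OF pos below q b] by blast
  obtain B C where BC: "geodesic_segment X d (c L) z B" "geodesic_segment X d z (c 0) C"
    using geo X unfolding geodesic_metric_space_def by blast
  have "geodesic_segment X d (c 0) (c L) (c ` {0..L})"
    unfolding geodesic_segment_def using c pos by (intro exI[of _ c] exI[of _ L]) auto
  with BC have tri: "geodesic_triangle X d (c 0) (c L) z (c ` {0..L}) B C"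
    by (simp add: geodesic_triangle_def)
  have comp: "comparison_triangle \<kappa> d (c 0) (c L) z x' y' z' A' B' C'"
    using tri' dist' L by (simp add: comparison_triangle_def commute)
  have "z \<in> B" using geodesic_segment_ends[OF BC(1)] by simp
  have "z' \<in> B'"
    using tri' geodesic_segment_ends(2)[of "model_space \<kappa> 2" "model_dist \<kappa> 2" y' z' B']
    by (simp add: geodesic_triangle_def)
  have "comparison_point \<kappa> d (c 0) (c L) z (c ` {0..L}) B C x' y' z' A' B' C' (c t) (m t)"
    unfolding comparison_point_def using m[OF t] c(2)[of t 0] t by auto
  moreover
  have "model_dist \<kappa> 2 z' y' = d z (c L)"
    using dist'(2) by (simp add: model_dist_chord chord_kappa_commute)
  with \<open>z \<in> B\<close> \<open>z' \<in> B'\<close> have "comparison_point \<kappa> d (c 0) (c L) z (c ` {0..L}) B C x' y' z' A' B' C' z z'"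
    unfolding comparison_point_def by blast
  moreover have "ereal (d (c 0) (c L) + d (c L) z + d z (c 0)) < 2 * D_kappa \<kappa>"
    using perimeter L by (simp add: below_D_half commute algebra_simps)
  moreover have "c t \<in> c ` {0..L} \<union> B \<union> C" "z \<in> c ` {0..L} \<union> B \<union> C"
    using \<open>z \<in> B\<close> t by auto
  ultimately have "d (c t) z \<le> model_dist \<kappa> 2 (m t) z'"
    using CAT tri comp unfolding CAT_def by meson
  then have "d z (c t) \<le> model_dist \<kappa> 2 z' (m t)"
    by (simp add: commute model_dist_chord chord_kappa_commute)
  then show ?thesis using m[OF t] by simp
qed


section \<open>The shortest broken line across the diagonal\<close>

text \<open>Let the base of a triangle in the model plane be parametrized by arc length \<open>t\<close>, starting at
  distance \<open>a\<close> from the apex, and let \<open>q\<close> be \<open>s_kappa \<kappa> a\<close> times the cosine of the angle at that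
  end. Then the point at parameter \<open>t\<close> has distance \<open>f = arc_kappa \<kappa> (apex_vers \<kappa> a q t)\<close> from the
  apex, and \<open>apex_slope \<kappa> a q t = s_kappa \<kappa> f * f'\<close>, where the derivative \<open>f'\<close> is the cosine of the angle there.\<close>

definition apex_vers :: "real \<Rightarrow> real \<Rightarrow> real \<Rightarrow> real \<Rightarrow> real" where
  "apex_vers \<kappa> a q t = vers_kappa \<kappa> a + vers_kappa \<kappa> t - \<kappa> * vers_kappa \<kappa> a * vers_kappa \<kappa> t - s_kappa \<kappa> t * q"

definition apex_slope :: "real \<Rightarrow> real \<Rightarrow> real \<Rightarrow> real \<Rightarrow> real" where
  "apex_slope \<kappa> a q t = s_kappa \<kappa> t * c_kappa \<kappa> a - c_kappa \<kappa> t * q"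

lemma apex_vers_0 [simp]: "apex_vers \<kappa> a q 0 = vers_kappa \<kappa> a"
  by (simp add: apex_vers_def)

lemma apex_vers_deriv: "(apex_vers \<kappa> a q has_real_derivative apex_slope \<kappa> a q t) (at t)"
  unfolding apex_vers_def[abs_def] apex_slope_def
  by (auto intro!: derivative_eq_intros s_kappa_deriv vers_kappa_deriv simp: c_kappa_vers algebra_simps)

text \<open>The left side is the square of \<open>s_kappa\<close> of the distance to the apex. By
  the law of sines, that \<open>s_kappa\<close> times the sine of the angle at the base point does
  not depend on \<open>t\<close>; its square is the last bracket.\<close>

lemma apex_slope_squared:
  "apex_vers \<kappa> a q t * (2 - \<kappa> * apex_vers \<kappa> a q t) = (apex_slope \<kappa> a q t)\<^sup>2 + ((s_kappa \<kappa> a)\<^sup>2 - q\<^sup>2)"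
  using s_kappa_squared_vers[of \<kappa> a] s_kappa_squared_vers[of \<kappa> t]
  unfolding apex_vers_def apex_slope_def c_kappa_vers by algebra

text \<open>The law of cosines at the base point \<open>t\<close>, looking back to the start of the
  base; \<open>apex_vers_add\<close> looks ahead to \<open>t + u\<close>, where the cosine changes
  sign.\<close>

lemma apex_vers_start:
  "vers_kappa \<kappa> a = vers_kappa \<kappa> t + apex_vers \<kappa> a q t - \<kappa> * vers_kappa \<kappa> t * apex_vers \<kappa> a q t
     - s_kappa \<kappa> t * apex_slope \<kappa> a q t"
  using s_kappa_squared_vers[of \<kappa> t]
  unfolding apex_vers_def apex_slope_def c_kappa_vers by algebra

lemma apex_vers_add:
  "apex_vers \<kappa> a q (t + u) = vers_kappa \<kappa> u + apex_vers \<kappa> a q t - \<kappa> * vers_kappa \<kappa> u * apex_vers \<kappa> a q t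
     + s_kappa \<kappa> u * apex_slope \<kappa> a q t"
  by (simp add: apex_vers_def apex_slope_def c_kappa_vers vers_kappa_add s_kappa_add algebra_simps)

text \<open>The value lies between those of the degenerate triangles,
  \<open>vers_kappa \<kappa> (a - t)\<close> and \<open>vers_kappa \<kappa> (a + t)\<close>, hence
  in the domain of \<open>arc_kappa \<kappa>\<close>.\<close>

lemma apex_vers_bounds:
  assumes "0 \<le> a" "below_D \<kappa> a" "0 \<le> t" "below_D \<kappa> t" "q\<^sup>2 \<le> (s_kappa \<kappa> a)\<^sup>2"
  shows "0 \<le> apex_vers \<kappa> a q t" "\<kappa> * apex_vers \<kappa> a q t \<le> 2"
proof -
  have s: "0 \<le> s_kappa \<kappa> a" "0 \<le> s_kappa \<kappa> t" using assms by (auto intro: s_kappa_nonneg)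
  have q: "\<bar>q\<bar> \<le> s_kappa \<kappa> a" using assms(5) s by (simp add: abs_le_square_iff[symmetric])
  have "s_kappa \<kappa> t * q \<le> s_kappa \<kappa> t * s_kappa \<kappa> a" "s_kappa \<kappa> t * - q \<le> s_kappa \<kappa> t * s_kappa \<kappa> a"
    using q s by (intro mult_left_mono; linarith)+
  then have "vers_kappa \<kappa> (a - t) \<le> apex_vers \<kappa> a q t" "apex_vers \<kappa> a q t \<le> vers_kappa \<kappa> (a + t)"
    unfolding vers_kappa_add vers_kappa_diff apex_vers_def by (simp_all add: mult.commute)
  then show *: "0 \<le> apex_vers \<kappa> a q t"
    using vers_kappa_nonneg[of \<kappa> "a - t"] by linarith
  show "\<kappa> * apex_vers \<kappa> a q t \<le> 2"
  proof (cases "\<kappa> > 0")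
    case True
    then have "\<kappa> * apex_vers \<kappa> a q t \<le> \<kappa> * vers_kappa \<kappa> (a + t)"
      using \<open>apex_vers \<kappa> a q t \<le> vers_kappa \<kappa> (a + t)\<close> by simp
    then show ?thesis using vers_kappa_le[of \<kappa> "a + t"] by linarith
  next
    case False
    with * have "\<kappa> * apex_vers \<kappa> a q t \<le> 0" by (simp add: mult_nonpos_nonneg)
    then show ?thesis by simp
  qed
qed

text \<open>Solves the law of cosines for \<open>q\<close>; through \<open>vers_kappa_mono\<close>
  the triangle inequalities say that the cosine has modulus at most 1.\<close>

lemma apex_parameter_exists:
  assumes nonneg: "0 \<le> a" "0 \<le> b" "0 < L"
    and triangle: "a \<le> b + L" "b \<le> a + L" "L \<le> a + b"
    and perimeter: "below_D \<kappa> ((a + b + L) / 2)"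
  obtains q where "q\<^sup>2 \<le> (s_kappa \<kappa> a)\<^sup>2" "vers_kappa \<kappa> b = apex_vers \<kappa> a q L"
proof -
  have below: "below_D \<kappa> u" if "u \<le> (a + b + L) / 2" for u
    using below_D_mono[OF perimeter that] .
  have L: "0 < s_kappa \<kappa> L" using assms by (intro s_kappa_pos below) auto
  have a: "0 \<le> s_kappa \<kappa> a" using assms by (intro s_kappa_nonneg below) auto
  define q where "q = (vers_kappa \<kappa> a + vers_kappa \<kappa> L - \<kappa> * vers_kappa \<kappa> a * vers_kappa \<kappa> L - vers_kappa \<kappa> b) / s_kappa \<kappa> L"
  have b: "vers_kappa \<kappa> b = apex_vers \<kappa> a q L"
    using L by (simp add: apex_vers_def q_def)
  have "vers_kappa \<kappa> (a - L) = vers_kappa \<kappa> \<bar>a - L\<bar>"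
    using vers_kappa_minus[of \<kappa> "a - L"] by (simp add: abs_if)
  also have "\<dots> \<le> vers_kappa \<kappa> b"
    using assms by (intro vers_kappa_mono below) (auto simp: abs_if)
  finally have "s_kappa \<kappa> L * q \<le> s_kappa \<kappa> L * s_kappa \<kappa> a"
    unfolding b vers_kappa_diff apex_vers_def by (simp add: mult.commute)
  moreover have "vers_kappa \<kappa> b \<le> vers_kappa \<kappa> (a + L)"
    using assms by (intro vers_kappa_mono below) auto
  then have "s_kappa \<kappa> L * - q \<le> s_kappa \<kappa> L * s_kappa \<kappa> a"
    unfolding b vers_kappa_add apex_vers_def by (simp add: mult.commute)
  ultimately have "\<bar>q\<bar> \<le> s_kappa \<kappa> a"
    using L by (simp only: mult_le_cancel_left_pos)
  then have "q\<^sup>2 \<le> (s_kappa \<kappa> a)\<^sup>2" using a by (simp add: abs_le_square_iff[symmetric])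
  with b show thesis by (rule that[rotated])
qed

lemma apex_arc_deriv:
  assumes F: "0 \<le> apex_vers \<kappa> a q t" "\<kappa> * apex_vers \<kappa> a q t \<le> 2"
    and f: "0 < arc_kappa \<kappa> (apex_vers \<kappa> a q t)" "below_D \<kappa> (arc_kappa \<kappa> (apex_vers \<kappa> a q t))"
  shows "((\<lambda>t. arc_kappa \<kappa> (apex_vers \<kappa> a q t)) has_real_derivative
    apex_slope \<kappa> a q t / s_kappa \<kappa> (arc_kappa \<kappa> (apex_vers \<kappa> a q t))) (at t)"
proof -
  let ?F = "apex_vers \<kappa> a q t"
  have s: "0 < s_kappa \<kappa> (arc_kappa \<kappa> ?F)" using f by (rule s_kappa_pos)
  have sq: "(s_kappa \<kappa> (arc_kappa \<kappa> ?F))\<^sup>2 = ?F * (2 - \<kappa> * ?F)"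
    using F by (simp add: s_kappa_squared_vers vers_arc_kappa)
  then have eq: "sqrt (?F * (2 - \<kappa> * ?F)) = s_kappa \<kappa> (arc_kappa \<kappa> ?F)"
    using s by (metis less_imp_le real_sqrt_unique)
  have "0 < ?F * (2 - \<kappa> * ?F)" using s sq by (metis zero_less_power)
  then have "0 < ?F" "\<kappa> * ?F < 2" using F by (auto simp: zero_less_mult_iff)
  from DERIV_chain'[OF apex_vers_deriv, where g = "arc_kappa \<kappa>", OF arc_kappa_deriv[OF this]]
  show ?thesis unfolding eq by simp
qed

text \<open>Brings the sign of the derivative at an endpoint into the shape of hypothesis
  \<open>angle\<close> of \<open>ptolemy_reflex\<close>, with \<open>w\<close> being
  \<open>s_kappa \<kappa> L\<close>.\<close>

lemma clear_denominators:
  fixes x y u v w :: real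
  assumes "x / u + y / v \<le> 0" "0 < u" "0 < v" "0 < w"
  shows "w * x * v + w * y * u \<le> 0"
proof -
  have "x * v + y * u \<le> 0"
    using assms mult_pos_pos[OF assms(2,3)] by (auto simp: add_frac_eq divide_le_0_iff dest: leD)
  then have "w * (x * v + y * u) \<le> 0"
    using assms by (intro mult_nonneg_nonpos) auto
  then show ?thesis by (simp add: distrib_left mult.assoc)
qed

lemma ptolemy_of_broken_lines:
  assumes pos: "0 < a" "0 < b" "0 < c" "0 < e" "0 < L"
    and triangle: "a \<le> b + c + e" "b \<le> a + c + e" "c \<le> a + b + e" "e \<le> a + b + c"
    and perimeter: "below_D \<kappa> ((a + b + c + e) / 2)" and L: "below_D \<kappa> L"
    and q: "q\<^sup>2 \<le> (s_kappa \<kappa> a)\<^sup>2" "vers_kappa \<kappa> b = apex_vers \<kappa> a q L"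
    and r: "r\<^sup>2 \<le> (s_kappa \<kappa> e)\<^sup>2" "vers_kappa \<kappa> c = apex_vers \<kappa> e r L"
    and D: "0 \<le> D" "\<And>t. t \<in> {0..L} \<Longrightarrow> D \<le> arc_kappa \<kappa> (apex_vers \<kappa> a q t) + arc_kappa \<kappa> (apex_vers \<kappa> e r t)"
  shows "s_kappa \<kappa> (L / 2) * s_kappa \<kappa> (D / 2)
    \<le> s_kappa \<kappa> (a / 2) * s_kappa \<kappa> (c / 2) + s_kappa \<kappa> (e / 2) * s_kappa \<kappa> (b / 2)"
proof -
  have below: "below_D \<kappa> u" if "u \<le> (a + b + c + e) / 2" for u
    using below_D_mono[OF perimeter that] .
  have belows: "below_D \<kappa> a" "below_D \<kappa> b" "below_D \<kappa> c" "below_D \<kappa> e"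
    using triangle by (auto intro!: below)
  have s_pos: "0 < s_kappa \<kappa> a" "0 < s_kappa \<kappa> b" "0 < s_kappa \<kappa> c" "0 < s_kappa \<kappa> e" "0 < s_kappa \<kappa> L"
    using pos belows L by (auto intro!: s_kappa_pos)
  have half_nonneg: "0 \<le> s_kappa \<kappa> (a / 2)" "0 \<le> s_kappa \<kappa> (b / 2)" "0 \<le> s_kappa \<kappa> (c / 2)"
      "0 \<le> s_kappa \<kappa> (e / 2)" "0 \<le> s_kappa \<kappa> (L / 2)"
    using pos belows L by (auto intro!: s_kappa_nonneg elim: below_D_mono)
  define f g h where "f t = arc_kappa \<kappa> (apex_vers \<kappa> a q t)" and "g t = arc_kappa \<kappa> (apex_vers \<kappa> e r t)"
    and "h t = f t + g t" for t
  have F: "0 \<le> apex_vers \<kappa> a q t" "\<kappa> * apex_vers \<kappa> a q t \<le> 2"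
    and G: "0 \<le> apex_vers \<kappa> e r t" "\<kappa> * apex_vers \<kappa> e r t \<le> 2" if "t \<in> {0..L}" for t
    using apex_vers_bounds[of a \<kappa> t q] apex_vers_bounds[of e \<kappa> t r] pos belows q r that below_D_mono[OF L, of t] by auto
  have ends: "f 0 = a" "f L = b" "g 0 = e" "g L = c"
    unfolding f_def g_def apex_vers_0 q(2)[symmetric] r(2)[symmetric]
    using pos belows by (simp_all add: arc_vers_kappa)
  have nonneg: "0 \<le> f t" "0 \<le> g t" if "t \<in> {0..L}" for t
    using F[OF that] G[OF that] by (simp_all add: f_def g_def arc_kappa_nonneg)
  have cont: "continuous_on {0..L} h"
    unfolding h_def f_def g_def
    by (intro continuous_intros continuous_on_compose2[OF arc_kappa_continuous]
        DERIV_continuous_on[OF DERIV_subset[OF apex_vers_deriv]]) (use F G in auto)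
  obtain t where t: "t \<in> {0..L}" and min: "\<And>s. s \<in> {0..L} \<Longrightarrow> h t \<le> h s"
    using continuous_attains_inf[OF compact_Icc _ cont] pos by auto
  have h_ends: "h 0 = a + e" "h L = b + c" by (simp_all add: h_def ends)
  \<comment> \<open>Being at most both end values, the minimum is at most their mean, half the
    perimeter of the quadrilateral.\<close>
  have "h t \<le> a + e" "h t \<le> b + c"
    using min[of 0] min[of L] pos h_ends by auto
  then have h_below: "below_D \<kappa> (h t)" by (intro below) (simp add: field_simps)
  have fg: "0 \<le> f t" "0 \<le> g t" using nonneg t by auto
  then have fg_below: "below_D \<kappa> (f t)" "below_D \<kappa> (g t)"
    by (auto intro!: below_D_mono[OF h_below] simp: h_def)
  have der: "(f has_real_derivative apex_slope \<kappa> a q t / s_kappa \<kappa> (f t)) (at t)" if "0 < f t"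
    unfolding f_def[abs_def] by (rule apex_arc_deriv) (use F t that fg_below in \<open>auto simp: f_def\<close>)
  have der': "(g has_real_derivative apex_slope \<kappa> e r t / s_kappa \<kappa> (g t)) (at t)" if "0 < g t"
    unfolding g_def[abs_def] by (rule apex_arc_deriv) (use G t that fg_below in \<open>auto simp: g_def\<close>)
  define h' where "h' = apex_slope \<kappa> a q t / s_kappa \<kappa> (f t) + apex_slope \<kappa> e r t / s_kappa \<kappa> (g t)"
  have h': "(h has_real_derivative h') (at t)" if "0 < f t" "0 < g t"
    unfolding h_def[abs_def] h'_def by (rule DERIV_add[OF der der']) (use that in auto)
  have "D \<le> h t" using D(2)[OF t] by (simp add: h_def f_def g_def)
  then have "s_kappa \<kappa> (D / 2) \<le> s_kappa \<kappa> (h t / 2)"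
    using D(1) by (intro s_kappa_mono below_D_mono[OF h_below]) auto
  then have "s_kappa \<kappa> (L / 2) * s_kappa \<kappa> (D / 2) \<le> s_kappa \<kappa> (L / 2) * s_kappa \<kappa> (h t / 2)"
    using half_nonneg by (intro mult_left_mono)
  also have "\<dots> \<le> s_kappa \<kappa> (a / 2) * s_kappa \<kappa> (c / 2) + s_kappa \<kappa> (e / 2) * s_kappa \<kappa> (b / 2)"
  proof -
    consider "t = 0" | "t = L" | "0 < t" "t < L" using t by fastforce
    then show ?thesis
    proof cases
      case 1
      \<comment> \<open>At the left end, \<open>h\<close> would otherwise decrease into the
        interval; the step \<open>min (\<delta> / 2) L\<close> stays within both
        \<open>\<delta>\<close> and the base. \<open>ptolemy_reflex\<close> is then used with the
        two ends of the base exchanged.\<close>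
      have "\<not> h' < 0"
      proof
        assume "h' < 0"
        then obtain \<delta> where "0 < \<delta>" "\<And>u. 0 < u \<Longrightarrow> u < \<delta> \<Longrightarrow> h (t + u) < h t"
          using DERIV_neg_dec_right[OF h'] ends pos 1 by auto
        then show False using min[of "t + min (\<delta> / 2) L"] pos 1
          by (smt (verit) atLeastAtMost_iff half_gt_zero field_sum_of_halves)
      qed
      then have "q / s_kappa \<kappa> a + r / s_kappa \<kappa> e \<le> 0"
        by (simp add: h'_def 1 ends apex_slope_def)
      then have "(s_kappa \<kappa> L * q) * s_kappa \<kappa> e + (s_kappa \<kappa> L * r) * s_kappa \<kappa> a \<le> 0"
        using s_pos by (intro clear_denominators)
      moreover have "s_kappa \<kappa> L * q = vers_kappa \<kappa> L + vers_kappa \<kappa> a - \<kappa> * vers_kappa \<kappa> L * vers_kappa \<kappa> a - vers_kappa \<kappa> b"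
        "s_kappa \<kappa> L * r = vers_kappa \<kappa> L + vers_kappa \<kappa> e - \<kappa> * vers_kappa \<kappa> L * vers_kappa \<kappa> e - vers_kappa \<kappa> c"
        unfolding q r by (simp_all add: apex_vers_def mult_ac)
      ultimately have "s_kappa \<kappa> (L / 2) * s_kappa \<kappa> ((a + e) / 2)
          \<le> s_kappa \<kappa> (b / 2) * s_kappa \<kappa> (e / 2) + s_kappa \<kappa> (c / 2) * s_kappa \<kappa> (a / 2)"
        using pos triangle perimeter \<open>h t \<le> b + c\<close>
        by (intro ptolemy_reflex) (auto simp: h_ends 1 add_ac)
      then show ?thesis by (simp add: h_ends 1 mult.commute add.commute)
    next
      case 2
      have "\<not> h' > 0"
      proof
        assume "h' > 0"
        then obtain \<delta> where "0 < \<delta>" "\<And>u. 0 < u \<Longrightarrow> u < \<delta> \<Longrightarrow> h (t - u) < h t"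
          using DERIV_pos_inc_left[OF h'] ends pos 2 by auto
        then show False using min[of "t - min (\<delta> / 2) L"] pos 2
          by (smt (verit) atLeastAtMost_iff half_gt_zero field_sum_of_halves)
      qed
      then have "apex_slope \<kappa> a q L / s_kappa \<kappa> b + apex_slope \<kappa> e r L / s_kappa \<kappa> c \<le> 0"
        by (simp add: h'_def 2 ends)
      then have "(s_kappa \<kappa> L * apex_slope \<kappa> a q L) * s_kappa \<kappa> c + (s_kappa \<kappa> L * apex_slope \<kappa> e r L) * s_kappa \<kappa> b \<le> 0"
        using s_pos by (intro clear_denominators)
      moreover have "s_kappa \<kappa> L * apex_slope \<kappa> a q L = vers_kappa \<kappa> L + vers_kappa \<kappa> b - \<kappa> * vers_kappa \<kappa> L * vers_kappa \<kappa> b - vers_kappa \<kappa> a"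
        "s_kappa \<kappa> L * apex_slope \<kappa> e r L = vers_kappa \<kappa> L + vers_kappa \<kappa> c - \<kappa> * vers_kappa \<kappa> L * vers_kappa \<kappa> c - vers_kappa \<kappa> e"
        using apex_vers_start[of \<kappa> a L q] apex_vers_start[of \<kappa> e L r] unfolding q r by simp_all
      ultimately have "s_kappa \<kappa> (L / 2) * s_kappa \<kappa> ((b + c) / 2)
          \<le> s_kappa \<kappa> (a / 2) * s_kappa \<kappa> (c / 2) + s_kappa \<kappa> (e / 2) * s_kappa \<kappa> (b / 2)"
        using pos triangle perimeter \<open>h t \<le> a + e\<close>
        by (intro ptolemy_reflex) (auto simp: h_ends 2)
      then show ?thesis by (simp add: h_ends 2)
    next
      case 3
      have vfg: "vers_kappa \<kappa> (f t) = apex_vers \<kappa> a q t" "vers_kappa \<kappa> (g t) = apex_vers \<kappa> e r t"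
        using F G t by (simp_all add: f_def g_def vers_arc_kappa)
      have slope: "(apex_slope \<kappa> a q t)\<^sup>2 \<le> (s_kappa \<kappa> (f t))\<^sup>2" "(apex_slope \<kappa> e r t)\<^sup>2 \<le> (s_kappa \<kappa> (g t))\<^sup>2"
        using apex_slope_squared[of \<kappa> a q t] apex_slope_squared[of \<kappa> e r t] q(1) r(1)
          s_kappa_squared_vers[of \<kappa> "f t"] s_kappa_squared_vers[of \<kappa> "g t"]
        unfolding vfg by linarith+
      have ratio: "\<bar>x / y\<bar> \<le> 1" if "x\<^sup>2 \<le> y\<^sup>2" for x y :: real
        using that by (cases "y = 0") (auto simp: abs_le_square_iff[symmetric])
      \<comment> \<open>At an interior minimum the two cosines are opposite. If a distance vanishes,
        \<open>h\<close> need not be differentiable, but the corresponding slope is 0 and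
        \<open>k\<close> is taken from the other triangle, or is 0 if both vanish.\<close>
      have "\<exists>k. \<bar>k\<bar> \<le> 1 \<and> apex_slope \<kappa> a q t = s_kappa \<kappa> (f t) * k \<and> apex_slope \<kappa> e r t = - (s_kappa \<kappa> (g t) * k)"
      proof -
        have zero: "f t = 0 \<Longrightarrow> apex_slope \<kappa> a q t = 0" "g t = 0 \<Longrightarrow> apex_slope \<kappa> e r t = 0"
          using slope by auto
        have s: "0 < f t \<Longrightarrow> 0 < s_kappa \<kappa> (f t)" "0 < g t \<Longrightarrow> 0 < s_kappa \<kappa> (g t)"
          using fg_below by (auto intro: s_kappa_pos)
        consider "f t = 0" "g t = 0" | "f t = 0" "0 < g t" | "0 < f t" "g t = 0" | "0 < f t" "0 < g t"
          using fg by fastforce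
        then show ?thesis
        proof cases
          case 1
          then show ?thesis using zero by (intro exI[of _ 0]) simp
        next
          case 2
          then show ?thesis using zero s ratio[OF slope(2)]
            by (intro exI[of _ "- (apex_slope \<kappa> e r t / s_kappa \<kappa> (g t))"]) auto
        next
          case 3
          then show ?thesis using zero s ratio[OF slope(1)]
            by (intro exI[of _ "apex_slope \<kappa> a q t / s_kappa \<kappa> (f t)"]) auto
        next
          case 4
          have "h' = 0"
          proof (rule DERIV_local_min[OF h'[OF 4]])
            show "0 < min t (L - t)" using \<open>0 < t\<close> \<open>t < L\<close> by simp
            have "y \<in> {0..L}" if "\<bar>t - y\<bar> < min t (L - t)" for y
              using that by (simp add: abs_if split: if_splits)
            then show "\<forall>y. \<bar>t - y\<bar> < min t (L - t) \<longrightarrow> h t \<le> h y" using min by blast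
          qed
          then have "apex_slope \<kappa> e r t / s_kappa \<kappa> (g t) = - (apex_slope \<kappa> a q t / s_kappa \<kappa> (f t))"
            by (simp add: h'_def)
          then have "apex_slope \<kappa> e r t = - (s_kappa \<kappa> (g t) * (apex_slope \<kappa> a q t / s_kappa \<kappa> (f t)))"
            using s(2)[OF 4(2)] by (simp add: divide_eq_eq mult.commute)
          then show ?thesis using s(1)[OF 4(1)] ratio[OF slope(1)]
            by (intro exI[of _ "apex_slope \<kappa> a q t / s_kappa \<kappa> (f t)"]) auto
        qed
      qed
      then obtain k where k: "\<bar>k\<bar> \<le> 1" "apex_slope \<kappa> a q t = s_kappa \<kappa> (f t) * k"
        "apex_slope \<kappa> e r t = - (s_kappa \<kappa> (g t) * k)" by blast
      \<comment> \<open>The minimum point cuts the diagonal into \<open>t\<close> and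
        \<open>L - t\<close> and serves as the crossing point.\<close>
      have "s_kappa \<kappa> ((t + (L - t)) / 2) * s_kappa \<kappa> ((f t + g t) / 2)
          \<le> s_kappa \<kappa> (a / 2) * s_kappa \<kappa> (c / 2) + s_kappa \<kappa> (e / 2) * s_kappa \<kappa> (b / 2)"
        using apex_vers_start[of \<kappa> a t q] apex_vers_start[of \<kappa> e t r]
          apex_vers_add[of \<kappa> a q t "L - t"] apex_vers_add[of \<kappa> e r t "L - t"] half_nonneg
        unfolding k(2,3) vfg[symmetric] using q(2) r(2)
        by (intro ptolemy_crossing[OF k(1)]) auto
      then show ?thesis by (simp add: h_def)
    qed
  qed
  finally show ?thesis .
qed

section \<open>Reduction to the model plane\<close>

theorem theorem4:
  fixes \<kappa> :: real
    and X :: "'a set"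
    and d :: "'a \<Rightarrow> 'a \<Rightarrow> real"
    and p\<^sub>1 p\<^sub>2 p\<^sub>3 p\<^sub>4 :: 'a
  assumes "CAT \<kappa> X d"
    and "p\<^sub>1 \<in> X" "p\<^sub>2 \<in> X" "p\<^sub>3 \<in> X" "p\<^sub>4 \<in> X"
    and "ereal (d p\<^sub>1 p\<^sub>2 + d p\<^sub>2 p\<^sub>3 + d p\<^sub>3 p\<^sub>4 + d p\<^sub>4 p\<^sub>1) < 2 * D_kappa \<kappa>"
  shows "s_kappa \<kappa> (d p\<^sub>1 p\<^sub>3 / 2) * s_kappa \<kappa> (d p\<^sub>2 p\<^sub>4 / 2)
       \<le> s_kappa \<kappa> (d p\<^sub>1 p\<^sub>2 / 2) * s_kappa \<kappa> (d p\<^sub>3 p\<^sub>4 / 2)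
         + s_kappa \<kappa> (d p\<^sub>4 p\<^sub>1 / 2) * s_kappa \<kappa> (d p\<^sub>2 p\<^sub>3 / 2)"
proof -
  have geo: "geodesic_metric_space X d" using assms by (simp add: CAT_def)
  then interpret Metric_space X d by (simp add: geodesic_metric_space_def)
  let ?a = "d p\<^sub>1 p\<^sub>2" and ?b = "d p\<^sub>2 p\<^sub>3" and ?c = "d p\<^sub>3 p\<^sub>4" and ?e = "d p\<^sub>4 p\<^sub>1" and ?L = "d p\<^sub>1 p\<^sub>3"
  have perimeter: "below_D \<kappa> ((?a + ?b + ?c + ?e) / 2)" using assms by (simp add: below_D_half)
  note X = assms(2-5)
  have tri: "?L \<le> ?a + ?b" "?a \<le> ?b + ?L" "?b \<le> ?a + ?L" "?L \<le> ?e + ?c" "?e \<le> ?c + ?L" "?c \<le> ?e + ?L"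
    using X triangle[of p\<^sub>1 p\<^sub>2 p\<^sub>3] triangle[of p\<^sub>1 p\<^sub>3 p\<^sub>2] triangle[of p\<^sub>2 p\<^sub>1 p\<^sub>3]
      triangle[of p\<^sub>1 p\<^sub>4 p\<^sub>3] triangle[of p\<^sub>1 p\<^sub>3 p\<^sub>4] triangle[of p\<^sub>4 p\<^sub>1 p\<^sub>3]
    by (simp_all add: commute)
  have below: "below_D \<kappa> u" if "u \<le> (?a + ?b + ?c + ?e) / 2" for u
    using below_D_mono[OF perimeter that] .
  show ?thesis
  proof (cases "p\<^sub>1 = p\<^sub>2 \<or> p\<^sub>2 = p\<^sub>3 \<or> p\<^sub>3 = p\<^sub>4 \<or> p\<^sub>4 = p\<^sub>1 \<or> p\<^sub>1 = p\<^sub>3")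
    case True
    \<comment> \<open>If neighbouring points coincide, the left side equals one term on the right
      and the other vanishes; if \<open>p\<^sub>1 = p\<^sub>3\<close>, the left side is 0.\<close>
    have "0 \<le> s_kappa \<kappa> (?a / 2)" "0 \<le> s_kappa \<kappa> (?b / 2)" "0 \<le> s_kappa \<kappa> (?c / 2)" "0 \<le> s_kappa \<kappa> (?e / 2)"
      by (auto intro!: s_kappa_nonneg below simp: add_divide_distrib)
    with True X show ?thesis by (auto simp: commute mult.commute)
  next
    case False
    then have pos: "0 < ?a" "0 < ?b" "0 < ?c" "0 < ?e" "0 < ?L"
      using X by (auto simp: less_le)
    obtain S where "geodesic_segment X d p\<^sub>1 p\<^sub>3 S"
      using geo X unfolding geodesic_metric_space_def by blast
    then obtain \<gamma> l where l: "0 \<le> l" and \<gamma>: "\<gamma> 0 = p\<^sub>1" "\<gamma> l = p\<^sub>3" "\<gamma> ` {0..l} \<subseteq> X"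
      "\<And>s t. s \<in> {0..l} \<Longrightarrow> t \<in> {0..l} \<Longrightarrow> d (\<gamma> s) (\<gamma> t) = \<bar>s - t\<bar>"
      unfolding geodesic_segment_def by blast
    have "l = ?L" using \<gamma>(4)[of 0 l] l \<gamma>(1,2) by simp
    note \<gamma> = \<gamma>[unfolded this]
    \<comment> \<open>Replacing two sides by the diagonal does not increase the perimeter.\<close>
    have per2: "below_D \<kappa> ((?a + ?b + ?L) / 2)" and per4: "below_D \<kappa> ((?e + ?c + ?L) / 2)"
      using tri by (auto intro!: below)
    obtain q where q: "q\<^sup>2 \<le> (s_kappa \<kappa> ?a)\<^sup>2" "vers_kappa \<kappa> ?b = apex_vers \<kappa> ?a q ?L"
      using apex_parameter_exists[of ?a ?b ?L \<kappa>] per2 pos tri by auto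
    obtain r where r: "r\<^sup>2 \<le> (s_kappa \<kappa> ?e)\<^sup>2" "vers_kappa \<kappa> ?c = apex_vers \<kappa> ?e r ?L"
      using apex_parameter_exists[of ?e ?c ?L \<kappa>] per4 pos tri by auto
    have "d p\<^sub>2 p\<^sub>4 \<le> arc_kappa \<kappa> (apex_vers \<kappa> ?a q t) + arc_kappa \<kappa> (apex_vers \<kappa> ?e r t)"
      if t: "t \<in> {0..?L}" for t
    proof -
      have "d p\<^sub>2 (\<gamma> t) \<le> arc_kappa \<kappa> (apex_vers \<kappa> ?a q t)"
        using CAT_dist_le[OF assms(1), of \<gamma> ?L p\<^sub>2 q t] \<gamma> X pos per2 q t
        by (simp add: apex_vers_def)
      moreover have "d p\<^sub>4 (\<gamma> t) \<le> arc_kappa \<kappa> (apex_vers \<kappa> ?e r t)"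
        using CAT_dist_le[OF assms(1), of \<gamma> ?L p\<^sub>4 r t] \<gamma> X pos per4 r t
        by (simp add: apex_vers_def commute)
      moreover have "d p\<^sub>2 p\<^sub>4 \<le> d p\<^sub>2 (\<gamma> t) + d p\<^sub>4 (\<gamma> t)"
        using triangle[of p\<^sub>2 "\<gamma> t" p\<^sub>4] X \<gamma>(3) t by (simp add: commute image_subset_iff)
      ultimately show ?thesis by linarith
    qed
    then show ?thesis
      using pos tri perimeter q r by (intro ptolemy_of_broken_lines) (auto intro!: below)
  qed
qed

end
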